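(* Let $L\ge 2$, $d_e\ge d$, let $v\in\mathbb R^d$ be fixed, and let $\{(X_i,z_i,y_i)\}_{i=1}^n$ be binary classification data satisfying the separability assumption, the equal non-optimal scores assumption, the initial loss assumption, and the data structure assumption (all four stated in the context). Let $K(t),Q(t)\in\mathbb R^{d\times d_e}$, $t\ge0$, be the gradient flow $$\dot K(t)=-\nabla_K\mathcal L(K(t),Q(t)),\qquad \dot Q(t)=-\nabla_Q\mathcal L(K(t),Q(t)),$$ and let $W(t)=K(t)Q(t)^\top$ and $\hat W(t)=W(t)/\mu(W(t))$. Suppose that the limit $\hat W^\infty:=\lim_{t\to\infty}\hat W(t)$ exists. Assume that the initialization satisfies the alignment property with respect to the data (see context), i.e. $$K(0)=U_K\Lambda_K(0)V^\top,\qquad Q(0)=U_Q\Lambda_Q(0)V^\top .$$ Let $\Lambda_K(t),\Lambda_Q(t)\in\mathbb R^{d\times d_e}$ be the diagonal matrices with $K(t)=U_K\Lambda_K(t)V^\top$ and $Q(t)=U_Q\Lambda_Q(t)V^\top$ (the alignment is preserved along the flow), let $\xi_k(t),\xi_q(t)\in\mathbb R^d$ be the diagonals of $\Lambda_K(t),\Lambda_Q(t)$, and let $\beta(t)=\xi_k(t)\odot\xi_q(t)$. Assume that, for some $\omega_0\in\mathbb R^d$ with all entries nonzero, $$\xi_k(0)\odot\xi_q(0)=0,\qquad \xi_k(0)^{\odot2}+\xi_q(0)^{\odot2}=2\,\omega_0^{\odot2}.$$ Then, with $\hat\beta^\infty:=\lim_{t\to\infty}\beta(t)/\mu(W(t))$,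 the limit $\hat W^\infty=U_K\,\mathrm{Diag}(\hat\beta^\infty)\,U_Q^\top$ is a global optimal solution of $$\min_{W\in\mathbb R^{d\times d},\ \mathrm{rank}(W)\le d_e}\|W\|_*\quad\text{s.t.}\quad (x_{i,\mathrm{opt}(i)}-x_{il})^\top Wz_i\ge1\quad\forall\,l\ne\mathrm{opt}(i),\ i\in[n],$$ where $\|\cdot\|_*$ is the nuclear norm.
   Context: Notation: $[n]=\{1,\dots,n\}$; $\odot$ is the entrywise product of vectors and $x^{\odot 2}=x\odot x$; $\mathrm{Diag}(x)$ is the diagonal matrix with diagonal $x$; $\sigma:\mathbb R^L\to\mathbb R^L$ is the softmax map $\sigma(x)_l=e^{x_l}/\sum_{m=1}^L e^{x_m}$. A matrix in $\mathbb R^{d\times d_e}$ is diagonal if its $(a,b)$ entries with $a\neq b$ vanish. Data: $X_i=[x_{i1},\dots,x_{iL}]^\top\in\mathbb R^{L\times d}$ (rows are tokens $x_{il}\in\mathbb R^d$), $z_i\in\mathbb R^d$, $y_i\in\{\pm1\}$. The score of token $x_{il}$ is $\gamma_{il}=y_i v^\top x_{il}$, and $\mathrm{opt}(i)\in\arg\max_{l\in[L]}\gamma_{il}$ is the index of an optimal token of sample $i$. Loss: $\mathcal L(K,Q)=\frac1n\sum_{i=1}^n \exp\big(-y_i v^\top X_i^\top\sigma(X_iKQ^\top z_i)\big)$ for $K,Q\in\mathbb R^{d\times d_e}$. Margin: for $W\in\mathbb R^{d\times d}$, $\mu(W)=\min_{i\in[n],\,l\ne\mathrm{opt}(i)}(x_{i,\mathrm{opt}(i)}-x_{il})^\top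 W z_i$. (Existence of the limit of $\hat W(t)$ includes that $\mu(W(t))\neq0$ for all sufficiently large $t$.) Separability assumption: $\mathrm{opt}(i)$ is unique for every $i\in[n]$, and there is $W_*\in\mathbb R^{d\times d}$ with $(x_{i,\mathrm{opt}(i)}-x_{il})^\top W_* z_i\ge 1$ for all $l\ne\mathrm{opt}(i)$, $i\in[n]$. Equal non-optimal scores assumption: for each $i\in[n]$ the optimal token is unique and all non-optimal tokens have the same score, i.e. $\gamma_{i,\mathrm{opt}(i)}>\gamma_{il}$ and $\gamma_{il}=\gamma_{il'}$ for all $l,l'\ne\mathrm{opt}(i)$; the common non-optimal score is denoted $\gamma_{i,\mathrm{nopt}}$. Initial loss assumption: $$\mathcal L(K(0),Q(0))\le\min_{j\in[n]}\frac{\exp(-\gamma_{j,\mathrm{nopt}})+\sum_{i\ne j}\exp(-\gamma_{i,\mathrm{opt}(i)})}{n}.$$ Data structure assumption: (i) for all $i\ne j$, $x_{i,\mathrm{opt}(i)}^\top x_{j,\mathrm{opt}(j)}=0$ and $z_i^\top z_j=0$; (ii) for all $i\in[n]$, $|x_{i,\mathrm{opt}(i)}^\top z_i|=\|x_{i,\mathrm{opt}(i)}\|_2\|z_i\|_2$; (iii) for each $i\in[n]$, the set of non-optimal indices $[L]\setminus\{\mathrm{opt}(i)\}$ can be partitioned into pairs $(l_{2k-1},l_{2k})$, $k=1,\dots,(L-1)/2$, such that for each pair there is a constant $c\in[-1,1)$ with $x_{i,\mathrm{opt}(i)}^\top(x_{i,l_{2k-1}}-x_{i,l_{2k}})=0$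 and $x_{i,l_{2k-1}}+x_{i,l_{2k}}=2c\,x_{i,\mathrm{opt}(i)}$. Alignment property: under the data structure assumption there exist orthogonal matrices $U_K,U_Q\in\mathbb R^{d\times d}$, with columns $u^k_1,\dots,u^k_d$ and $u^q_1,\dots,u^q_d$, and a one-to-one map $\pi:[n]\to[d]$, such that for all $i\in[n]$, $x_{i,\mathrm{opt}(i)}/\|x_{i,\mathrm{opt}(i)}\|_2=u^k_{\pi(i)}$ and $z_i/\|z_i\|_2=u^q_{\pi(i)}$. Fix such $U_K,U_Q$. Matrices $K,Q\in\mathbb R^{d\times d_e}$ satisfy the alignment property with respect to the data if $K=U_K\Lambda_KV^\top$ and $Q=U_Q\Lambda_QV^\top$ for some orthogonal $V\in\mathbb R^{d_e\times d_e}$ and diagonal $\Lambda_K,\Lambda_Q\in\mathbb R^{d\times d_e}$. *)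

theory Defs
  imports "HOL-Analysis.Analysis"
begin

section \<open>Matrices\<close>

text \<open>
  A $d \times d_e$ matrix has type \<open>real ^ 'e ^ 'd\<close>.  To speak of the \<open>(a,b)\<close> entry with
  $a = b$ when the row and column index types differ, an index of a finite linearly ordered type
  is identified with its (zero-based) rank in the order.
\<close>

definition pos :: "'a::{finite,linorder} \<Rightarrow> nat" where
  "pos a = card {b. b < a}"

definition diagonal_matrix :: "'s::zero ^ 'e::{finite,linorder} ^ 'd::{finite,linorder} \<Rightarrow> bool" where
  "diagonal_matrix A \<longleftrightarrow> (\<forall>a b. pos a \<noteq> pos b \<longrightarrow> A $ a $ b = 0)"

text \<open>
  The diagonal, as a vector indexed by the rows.  The column is uniquely determined whenever
  there are at least as many columns as rows.
\<close>

definition diagonal_of :: "'s ^ 'e::{finite,linorder} ^ 'd::{finite,linorder} \<Rightarrow> 's ^ 'd::{finite,linorder}" where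
  "diagonal_of A = (\<chi> a. A $ a $ (THE b. pos b = pos a))"

definition Diag :: "'s::zero ^ 'd \<Rightarrow> 's ^ 'd ^ 'd" where
  "Diag x = (\<chi> a b. if a = b then x $ a else 0)"

text \<open>
  The nuclear norm is the sum of the singular values, i.e. of the square roots of the eigenvalues
  of \<open>transpose A ** A\<close>, each counted with the dimension of its eigenspace.
\<close>

definition singular_values :: "real ^ 'n ^ 'm \<Rightarrow> real set" where
  "singular_values A =
     {s. 0 \<le> s \<and> (\<exists>x. x \<noteq> 0 \<and> (transpose A ** A) *v x = s\<^sup>2 *\<^sub>R x)}"

definition nuclear_norm :: "real ^ 'n ^ 'm \<Rightarrow> real" where
  "nuclear_norm A =
     (\<Sum>s\<in>singular_values A. real (dim {x. (transpose A ** A) *v x = s\<^sup>2 *\<^sub>R x}) * s)"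

lemma finite_singular_values: "finite (singular_values A)"
proof -
  let ?M = "transpose A ** A"
  have sym: "(?M *v x) \<bullet> y = x \<bullet> (?M *v y)" for x y
    by (metis dot_lmul_matrix matrix_transpose_mul transpose_transpose vector_transpose_matrix)
  define f where "f s = (SOME x. x \<noteq> 0 \<and> ?M *v x = s\<^sup>2 *\<^sub>R x)" for s :: real
  have f: "f s \<noteq> 0" "?M *v f s = s\<^sup>2 *\<^sub>R f s" if "s \<in> singular_values A" for s
    using that someI_ex[of "\<lambda>x. x \<noteq> 0 \<and> ?M *v x = s\<^sup>2 *\<^sub>R x"]
    unfolding singular_values_def f_def by blast+
  have orth: "f s \<bullet> f t = 0"
    if st: "s \<in> singular_values A" "t \<in> singular_values A" "s \<noteq> t" for s t
  proof -
    have "s\<^sup>2 * (f s \<bullet> f t) = t\<^sup>2 * (f s \<bullet> f t)"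
      using sym[of "f s" "f t"] f(2)[OF st(1)] f(2)[OF st(2)] by simp
    moreover have "s\<^sup>2 \<noteq> t\<^sup>2"
      using st by (auto simp: singular_values_def power2_eq_iff)
    ultimately show ?thesis by simp
  qed
  have "inj_on f (singular_values A)"
    by (rule inj_onI) (metis f(1) inner_eq_zero_iff orth)
  moreover have "pairwise orthogonal (f ` singular_values A)"
    unfolding pairwise_def orthogonal_def using orth by auto
  then have "finite (f ` singular_values A)"
    by (rule pairwise_orthogonal_imp_finite)
  ultimately show ?thesis
    using finite_imageD by blast
qed


section \<open>Data, loss and gradient flow\<close>

text \<open>
  Sample \<open>i\<close> consists of a token matrix \<open>X i :: real ^ 'd ^ 'l\<close>, whose rows \<open>X i $ l\<close> are the
  tokens, a vector \<open>z i\<close> and a label \<open>y i\<close>.  On \<open>real ^ 'e ^ 'd\<close> the inner product is the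
  Frobenius inner product, so \<open>gradient\<close> is the usual matrix gradient.
\<close>

definition softmax :: "real ^ 'l \<Rightarrow> real ^ 'l" where
  "softmax x = (\<chi> l. exp (x $ l) / (\<Sum>m\<in>UNIV. exp (x $ m)))"

definition loss ::
  "('n::finite \<Rightarrow> real ^ 'd ^ 'l) \<Rightarrow> ('n \<Rightarrow> real ^ 'd) \<Rightarrow> ('n \<Rightarrow> real) \<Rightarrow> real ^ 'd \<Rightarrow>
   real ^ 'e ^ 'd \<Rightarrow> real ^ 'e ^ 'd \<Rightarrow> real" where
  "loss X z y v K Q = (1 / real CARD('n)) *
     (\<Sum>i\<in>UNIV. exp (- y i *
        (v \<bullet> (transpose (X i) *v softmax ((X i ** K ** transpose Q) *v z i)))))"

definition gradient :: "('a::real_inner \<Rightarrow> real) \<Rightarrow> 'a \<Rightarrow> 'a" where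
  "gradient f x = (THE G. GDERIV f x :> G)"

lemma gradient_eqI:
  assumes "GDERIV f x :> G"
  shows "gradient f x = G"
  unfolding gradient_def
proof (rule the_equality[where P = "\<lambda>G. GDERIV f x :> G", OF assms])
  fix H assume "GDERIV f x :> H"
  then have "(\<lambda>h. h \<bullet> H) = (\<lambda>h. h \<bullet> G)"
    using assms has_derivative_unique unfolding gderiv_def by blast
  then have "(H - G) \<bullet> H = (H - G) \<bullet> G"
    by meson
  then have "(H - G) \<bullet> (H - G) = 0"
    by (simp add: inner_diff_right)
  then show "H = G" by simp
qed

definition gradient_flow ::
  "('a::real_inner \<Rightarrow> 'b::real_inner \<Rightarrow> real) \<Rightarrow> (real \<Rightarrow> 'a) \<Rightarrow> (real \<Rightarrow> 'b) \<Rightarrow> bool" where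
  "gradient_flow f K Q \<longleftrightarrow> (\<forall>t\<ge>0.
     (K has_vector_derivative - gradient (\<lambda>A. f A (Q t)) (K t)) (at t within {0..}) \<and>
     (Q has_vector_derivative - gradient (\<lambda>B. f (K t) B) (Q t)) (at t within {0..}))"


section \<open>Scores, margins and assumptions on the data\<close>

definition score ::
  "('n \<Rightarrow> real ^ 'd ^ 'l) \<Rightarrow> ('n \<Rightarrow> real) \<Rightarrow> real ^ 'd \<Rightarrow> 'n \<Rightarrow> 'l \<Rightarrow> real" where
  "score X y v i l = y i * (v \<bullet> X i $ l)"

definition optimal_token ::
  "('n \<Rightarrow> real ^ 'd ^ 'l) \<Rightarrow> ('n \<Rightarrow> real) \<Rightarrow> real ^ 'd \<Rightarrow> 'n \<Rightarrow> 'l \<Rightarrow> bool" where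
  "optimal_token X y v i l \<longleftrightarrow> is_arg_max (score X y v i) (\<lambda>_. True) l"

definition sample_margin ::
  "('n \<Rightarrow> real ^ 'd ^ 'l) \<Rightarrow> ('n \<Rightarrow> real ^ 'd) \<Rightarrow> ('n \<Rightarrow> 'l) \<Rightarrow>
   real ^ 'd ^ 'd \<Rightarrow> 'n \<Rightarrow> 'l \<Rightarrow> real" where
  "sample_margin X z opt W i l = (X i $ opt i - X i $ l) \<bullet> (W *v z i)"

definition margin ::
  "('n::finite \<Rightarrow> real ^ 'd ^ 'l::finite) \<Rightarrow> ('n \<Rightarrow> real ^ 'd) \<Rightarrow> ('n \<Rightarrow> 'l) \<Rightarrow>
   real ^ 'd ^ 'd \<Rightarrow> real" where
  "margin X z opt W = Min {sample_margin X z opt W i l | i l. l \<noteq> opt i}"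

definition margin_feasible ::
  "('n \<Rightarrow> real ^ 'd ^ 'l) \<Rightarrow> ('n \<Rightarrow> real ^ 'd) \<Rightarrow> ('n \<Rightarrow> 'l) \<Rightarrow> real ^ 'd ^ 'd \<Rightarrow> bool" where
  "margin_feasible X z opt W \<longleftrightarrow> (\<forall>i l. l \<noteq> opt i \<longrightarrow> sample_margin X z opt W i l \<ge> 1)"

definition separable ::
  "('n \<Rightarrow> real ^ 'd ^ 'l) \<Rightarrow> ('n \<Rightarrow> real ^ 'd) \<Rightarrow> ('n \<Rightarrow> real) \<Rightarrow> real ^ 'd \<Rightarrow> ('n \<Rightarrow> 'l) \<Rightarrow> bool" where
  "separable X z y v opt \<longleftrightarrow>
     (\<forall>i. \<exists>!l. optimal_token X y v i l) \<and> (\<exists>W. margin_feasible X z opt W)"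

definition equal_nonopt_scores ::
  "('n \<Rightarrow> real ^ 'd ^ 'l) \<Rightarrow> ('n \<Rightarrow> real) \<Rightarrow> real ^ 'd \<Rightarrow> ('n \<Rightarrow> 'l) \<Rightarrow> bool" where
  "equal_nonopt_scores X y v opt \<longleftrightarrow>
     (\<forall>i l l'. l \<noteq> opt i \<and> l' \<noteq> opt i \<longrightarrow>
        score X y v i (opt i) > score X y v i l \<and> score X y v i l = score X y v i l')"

text \<open>The common non-optimal score, meaningful under \<^const>\<open>equal_nonopt_scores\<close> if there are
  at least two tokens.\<close>

definition nonopt_score ::
  "('n \<Rightarrow> real ^ 'd ^ 'l) \<Rightarrow> ('n \<Rightarrow> real) \<Rightarrow> real ^ 'd \<Rightarrow> ('n \<Rightarrow> 'l) \<Rightarrow> 'n \<Rightarrow> real" where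
  "nonopt_score X y v opt i = (THE g. \<forall>l. l \<noteq> opt i \<longrightarrow> score X y v i l = g)"

definition initial_loss_bound ::
  "('n::finite \<Rightarrow> real ^ 'd ^ 'l) \<Rightarrow> ('n \<Rightarrow> real) \<Rightarrow> real ^ 'd \<Rightarrow> ('n \<Rightarrow> 'l) \<Rightarrow> real" where
  "initial_loss_bound X y v opt =
     (MIN j. (exp (- nonopt_score X y v opt j)
              + (\<Sum>i\<in>UNIV - {j}. exp (- score X y v i (opt i)))) / real CARD('n))"

text \<open>In the last clause the conditions are symmetric in the two members of a pair, so a partition
  into pairs is a partition into two-element sets.\<close>

definition data_structure ::
  "('n \<Rightarrow> real ^ 'd ^ 'l) \<Rightarrow> ('n \<Rightarrow> real ^ 'd) \<Rightarrow> ('n \<Rightarrow> 'l) \<Rightarrow> bool" where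
  "data_structure X z opt \<longleftrightarrow>
     (\<forall>i j. i \<noteq> j \<longrightarrow> X i $ opt i \<bullet> X j $ opt j = 0 \<and> z i \<bullet> z j = 0) \<and>
     (\<forall>i. \<bar>X i $ opt i \<bullet> z i\<bar> = norm (X i $ opt i) * norm (z i)) \<and>
     (\<forall>i. \<exists>P. partition_on (UNIV - {opt i}) P \<and>
        (\<forall>p\<in>P. \<exists>l l'. l \<noteq> l' \<and> p = {l, l'} \<and>
           (\<exists>c. -1 \<le> c \<and> c < 1 \<and>
              X i $ opt i \<bullet> (X i $ l - X i $ l') = 0 \<and>
              X i $ l + X i $ l' = (2 * c) *\<^sub>R X i $ opt i)))"

text \<open>The orthogonal matrices \<open>UK\<close>, \<open>UQ\<close> adapted to the data.\<close>

definition alignment_bases ::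
  "('n \<Rightarrow> real ^ 'd ^ 'l) \<Rightarrow> ('n \<Rightarrow> real ^ 'd) \<Rightarrow> ('n \<Rightarrow> 'l) \<Rightarrow>
   real ^ 'd ^ 'd \<Rightarrow> real ^ 'd ^ 'd \<Rightarrow> bool" where
  "alignment_bases X z opt UK UQ \<longleftrightarrow>
     orthogonal_matrix UK \<and> orthogonal_matrix UQ \<and>
     (\<exists>\<pi>::'n \<Rightarrow> 'd. inj \<pi> \<and>
        (\<forall>i. (1 / norm (X i $ opt i)) *\<^sub>R X i $ opt i = column (\<pi> i) UK \<and>
             (1 / norm (z i)) *\<^sub>R z i = column (\<pi> i) UQ))"

end

theory Submission
  imports Defs "HOL-Real_Asymp.Real_Asymp"
begin

text \<open>
  In the bases \<open>UK\<close>, \<open>UQ\<close>, \<open>V\<close> the squared size of the off-diagonal entries of the two factors satisfies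
  a Gronwall inequality: the two tokens of a pair have equal softmax weights up to an error linear in the
  off-diagonal entries, so their components orthogonal to the optimal token nearly cancel in the gradient.
  Hence the factors stay diagonal, and their diagonals solve decoupled systems \<open>k' = g q\<close>, \<open>q' = g k\<close> in which
  \<open>g\<close> is comparable to \<open>exp (- r\<^sub>i \<beta>\<^sub>i)\<close> for \<open>\<beta>\<^sub>i = k q\<close>, where \<open>r\<^sub>i \<beta>\<^sub>i\<close> is the margin of sample \<open>i\<close>.
  Since \<open>k\<^sup>2 - q\<^sup>2\<close> is conserved, \<open>k\<^sup>2 + q\<^sup>2\<close> lies between a positive constant and a linear function of \<open>\<beta>\<^sub>i\<close>,
  so every \<open>r\<^sub>i \<beta>\<^sub>i\<close> is asymptotic to \<open>ln t\<close>, and so is the margin; the normalised limit has entries \<open>1 / r\<^sub>i\<close>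
  and nuclear norm \<open>\<Sum>\<^sub>i 1 / r\<^sub>i\<close>.  Averaging the constraints of the worst pair of sample \<open>i\<close> shows that every
  feasible \<open>W\<close> has \<open>u\<^sub>i \<bullet> W w\<^sub>i \<ge> 1 / r\<^sub>i\<close> in the orthonormal directions of the data, and
  \<open>\<Sum>\<^sub>i u\<^sub>i \<bullet> W w\<^sub>i\<close> is a lower bound for the nuclear norm.
\<close>

section \<open>Spectral theory and the nuclear norm\<close>

text \<open>Variational principle: the Rayleigh quotient attains its maximum on the compact unit
  sphere of \<open>S\<close>, and a maximiser is an eigenvector because the residual
  \<open>l *\<^sub>R x0 - f x0\<close> stays in \<open>S\<close> and is an admissible direction of
  variation.\<close>

lemma symmetric_invariant_subspace_eigenvector:
  fixes f :: "'a::euclidean_space \<Rightarrow> 'a"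
  assumes f: "linear f" and sym: "\<And>x y. f x \<bullet> y = x \<bullet> f y"
    and S: "subspace S" and inv: "\<And>x. x \<in> S \<Longrightarrow> f x \<in> S" and nz: "S \<noteq> {0}"
  obtains x l where "x \<in> S" "norm x = 1" "f x = l *\<^sub>R x"
proof -
  obtain x1 where x1: "x1 \<in> S" "x1 \<noteq> 0"
    using nz S subspace_0 by blast
  have "compact (S \<inter> sphere 0 1)"
    using closed_subspace[OF S] by (intro closed_Int_compact) auto
  moreover have "(1 / norm x1) *\<^sub>R x1 \<in> S \<inter> sphere 0 1"
    using x1 S by (auto simp: subspace_scale)
  then have "S \<inter> sphere 0 1 \<noteq> {}" by blast
  moreover have "continuous_on (S \<inter> sphere 0 1) (\<lambda>x. x \<bullet> f x)"
    using f by (intro continuous_intros linear_continuous_on) (simp add: linear_conv_bounded_linear)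
  ultimately obtain x0 where x0: "x0 \<in> S" "norm x0 = 1"
    and max: "\<And>y. y \<in> S \<Longrightarrow> norm y = 1 \<Longrightarrow> y \<bullet> f y \<le> x0 \<bullet> f x0"
    using continuous_attains_sup[of "S \<inter> sphere 0 1" "\<lambda>x. x \<bullet> f x"] by (metis IntE IntI mem_sphere_0)
  define l where "l = x0 \<bullet> f x0"
  have le: "0 \<le> l * (y \<bullet> y) - y \<bullet> f y" if "y \<in> S" for y
  proof (cases "y = 0")
    case False
    have "((1 / norm y) *\<^sub>R y) \<bullet> f ((1 / norm y) *\<^sub>R y) \<le> l"
      unfolding l_def using that False S by (intro max) (auto simp: subspace_scale)
    then have "(y \<bullet> f y) / (norm y)\<^sup>2 \<le> l"
      by (simp add: linear_cmul[OF f] power2_eq_square)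
    then show ?thesis
      using False by (simp add: divide_le_eq power2_norm_eq_inner)
  qed simp
  define h where "h = l *\<^sub>R x0 - f x0"
  have hS: "h \<in> S"
    unfolding h_def using x0 inv S by (auto intro: subspace_diff subspace_scale)
  define q where "q = l * (h \<bullet> h) - h \<bullet> f h"
  \<comment> \<open>The form \<open>l * (y \<bullet> y) - y \<bullet> f y\<close> is nonnegative on \<open>S\<close> and vanishes at \<open>x0\<close>, so its derivative at \<open>x0\<close> in
    the direction \<open>h\<close> vanishes.\<close>
  have expand: "0 \<le> - 2 * t * (h \<bullet> h) + t\<^sup>2 * q" for t
  proof -
    have "0 \<le> l * ((x0 - t *\<^sub>R h) \<bullet> (x0 - t *\<^sub>R h)) - (x0 - t *\<^sub>R h) \<bullet> f (x0 - t *\<^sub>R h)"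
      using x0 hS S by (intro le) (auto intro: subspace_diff subspace_scale)
    also have "\<dots> = (l * (x0 \<bullet> x0) - l) - 2 * t * ((l *\<^sub>R x0 - f x0) \<bullet> h) + t\<^sup>2 * q"
    proof -
      have "x0 \<bullet> f h = f x0 \<bullet> h" "h \<bullet> f x0 = f x0 \<bullet> h"
        by (rule sym[symmetric], rule inner_commute)
      then show ?thesis
        unfolding q_def l_def linear_diff[OF f] linear_cmul[OF f] inner_diff
        by (simp add: inner_commute[of h x0] power2_eq_square algebra_simps)
    qed
    also have "\<dots> = - 2 * t * (h \<bullet> h) + t\<^sup>2 * q"
      using x0 by (simp add: h_def norm_eq_1)
    finally show ?thesis .
  qed
  have "h \<bullet> h = 0"
  proof (rule ccontr)
    assume "h \<bullet> h \<noteq> 0"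
    then have hh: "h \<bullet> h > 0" by (simp add: less_le)
    \<comment> \<open>This choice gives \<open>t * q \<le> h \<bullet> h\<close>, so the quadratic
      term of \<open>expand\<close> offsets at most half of the linear one.\<close>
    define t where "t = (h \<bullet> h) / (1 + \<bar>q\<bar>)"
    have t: "t > 0" "t * (1 + \<bar>q\<bar>) = h \<bullet> h" using hh by (auto simp: t_def)
    have "t * q \<le> t * (1 + \<bar>q\<bar>)" using t by (intro mult_left_mono) auto
    then have "t * (t * q) \<le> t * (h \<bullet> h)" using t by (intro mult_left_mono) auto
    then have "t * (h \<bullet> h) \<le> 0"
      using expand[of t] by (simp add: power2_eq_square)
    then show False using t hh by (simp add: mult_le_0_iff)
  qed
  then have "f x0 = l *\<^sub>R x0" by (simp add: h_def)
  then show thesis using that x0 by blast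
qed

lemma orthonormal_imp_independent:
  fixes B :: "'a::euclidean_space set"
  assumes "pairwise orthogonal B" "\<And>b. b \<in> B \<Longrightarrow> norm b = 1"
  shows "independent B"
  using assms pairwise_orthogonal_independent by fastforce

text \<open>Take an orthonormal set of eigenvectors of largest cardinality. By symmetry its
  orthogonal complement is invariant under \<open>f\<close>; were it nonzero, it would contain
  another unit eigenvector.\<close>

lemma symmetric_orthonormal_eigenbasis:
  fixes f :: "'a::euclidean_space \<Rightarrow> 'a"
  assumes f: "linear f" and sym: "\<And>x y. f x \<bullet> y = x \<bullet> f y"
  obtains B where "pairwise orthogonal B" "\<And>b. b \<in> B \<Longrightarrow> norm b = 1"
    "\<And>b. b \<in> B \<Longrightarrow> \<exists>l. f b = l *\<^sub>R b" "span B = UNIV"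
proof -
  define P where "P B \<longleftrightarrow> pairwise orthogonal B \<and> (\<forall>b\<in>B. norm b = 1 \<and> (\<exists>l. f b = l *\<^sub>R b))" for B
  have ind: "independent B" if "P B" for B
    using that orthonormal_imp_independent unfolding P_def by blast
  have "P {}" by (simp add: P_def)
  then obtain B where B: "P B" and max: "\<And>C. P C \<Longrightarrow> card C \<le> card B"
    using ex_has_greatest_nat[of P "{}" card "Suc (DIM('a))"] independent_card_le[OF ind]
    by (metis le_imp_less_Suc)
  have finB: "finite B" using ind[OF B] independent_bound by blast
  define S where "S = {x. \<forall>b\<in>B. b \<bullet> x = 0}"
  have S: "subspace S"
    by (auto simp: S_def subspace_def inner_add_right)
  have inv: "f x \<in> S" if "x \<in> S" for x
    unfolding S_def
  proof (intro CollectI ballI)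
    fix b assume b: "b \<in> B"
    then obtain l where "f b = l *\<^sub>R b" using B by (auto simp: P_def)
    then have "b \<bullet> f x = l * (b \<bullet> x)" by (metis sym inner_scaleR_left)
    then show "b \<bullet> f x = 0" using that b by (simp add: S_def)
  qed
  have "S = {0}"
  proof (rule ccontr)
    assume "S \<noteq> {0}"
    then obtain x l where x: "x \<in> S" "norm x = 1" "f x = l *\<^sub>R x"
      using symmetric_invariant_subspace_eigenvector[OF f sym S inv] by metis
    have "x \<notin> B" using x by (auto simp: S_def)
    moreover have "P (insert x B)"
      using B x unfolding P_def pairwise_insert orthogonal_def S_def by (auto simp: inner_commute)
    ultimately show False using max[of "insert x B"] finB by simp
  qed
  have "span B = UNIV"
  proof (rule ccontr)
    assume "span B \<noteq> UNIV"
    then obtain x where "x \<notin> span B" by auto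
    then obtain a where "a \<noteq> 0" "\<And>y. y \<in> span B \<Longrightarrow> orthogonal a y"
      using orthogonal_to_subspace_exists_gen[of B UNIV] by auto
    then have "a \<in> S" by (auto simp: S_def orthogonal_def inner_commute span_base)
    then show False using \<open>a \<noteq> 0\<close> \<open>S = {0}\<close> by simp
  qed
  then show thesis using that[of B] B by (auto simp: P_def)
qed

lemma orthonormal_basis_expansion:
  fixes B :: "'a::euclidean_space set"
  assumes "pairwise orthogonal B" "\<And>b. b \<in> B \<Longrightarrow> norm b = 1" "span B = UNIV"
  shows "x = (\<Sum>b\<in>B. (x \<bullet> b) *\<^sub>R b)"
proof -
  have "finite B"
    using assms orthonormal_imp_independent independent_bound by blast
  then show ?thesis
    using orthonormal_basis_expand[OF assms(1,2), of x] assms(3) by simp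
qed

text \<open>The definition of the nuclear norm runs over distinct singular values, weighted by
  eigenspace dimension. Grouping the basis by the value of \<open>\<sigma>\<close> matches the two
  sums, since each eigenspace is spanned by the basis vectors with that value.\<close>

lemma nuclear_norm_eigenbasis:
  fixes A :: "real ^ 'n ^ 'm"
  assumes orth: "pairwise orthogonal B" and unit: "\<And>b. b \<in> B \<Longrightarrow> norm b = 1" and span: "span B = UNIV"
    and eig: "\<And>b. b \<in> B \<Longrightarrow> (transpose A ** A) *v b = (\<sigma> b)\<^sup>2 *\<^sub>R b" and pos: "\<And>b. b \<in> B \<Longrightarrow> 0 \<le> \<sigma> b"
  shows "nuclear_norm A = (\<Sum>b\<in>B. \<sigma> b)"
proof -
  let ?M = "transpose A ** A"
  have indep: "independent B" using orthonormal_imp_independent orth unit by blast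
  then have fin: "finite B" using independent_bound by blast
  have nz: "b \<noteq> 0" if "b \<in> B" for b using unit[OF that] by auto
  have eigenspace: "{x. ?M *v x = t\<^sup>2 *\<^sub>R x} = span {b\<in>B. \<sigma> b = t}" if t: "0 \<le> t" for t
  proof
    have "subspace {x. ?M *v x = t\<^sup>2 *\<^sub>R x}"
      by (auto simp: subspace_def matrix_vector_right_distrib matrix_vector_mult_scaleR scaleR_add_right)
    then show "span {b\<in>B. \<sigma> b = t} \<subseteq> {x. ?M *v x = t\<^sup>2 *\<^sub>R x}"
      using eig by (intro span_minimal) auto
    show "{x. ?M *v x = t\<^sup>2 *\<^sub>R x} \<subseteq> span {b\<in>B. \<sigma> b = t}"
    proof safe
      fix x assume x: "?M *v x = t\<^sup>2 *\<^sub>R x"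
      have sym: "(?M *v u) \<bullet> w = u \<bullet> (?M *v w)" for u w
        by (metis dot_lmul_matrix matrix_transpose_mul transpose_transpose vector_transpose_matrix)
      \<comment> \<open>Eigenvectors for different eigenvalues are orthogonal; nonnegativity of
        \<open>\<sigma> b\<close> and \<open>t\<close> is what makes different values have different
        squares.\<close>
      have zero: "x \<bullet> b = 0" if "b \<in> B" "\<sigma> b \<noteq> t" for b
      proof -
        have "t\<^sup>2 * (x \<bullet> b) = (\<sigma> b)\<^sup>2 * (x \<bullet> b)"
          using sym[of x b] x eig[OF that(1)] by simp
        then show ?thesis using that pos t by (auto simp: power2_eq_iff_nonneg)
      qed
      have "(\<Sum>b\<in>B. (x \<bullet> b) *\<^sub>R b) \<in> span {b\<in>B. \<sigma> b = t}"
      proof (rule span_sum)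
        fix b assume "b \<in> B"
        then show "(x \<bullet> b) *\<^sub>R b \<in> span {b\<in>B. \<sigma> b = t}"
          using zero[of b] by (cases "\<sigma> b = t") (auto intro: span_scale span_base span_zero)
      qed
      then show "x \<in> span {b\<in>B. \<sigma> b = t}"
        using orthonormal_basis_expansion[OF orth unit span, of x] by simp
    qed
  qed
  have dims: "dim {x. ?M *v x = t\<^sup>2 *\<^sub>R x} = card {b\<in>B. \<sigma> b = t}" if "0 \<le> t" for t
    unfolding eigenspace[OF that] dim_span
    by (rule dim_eq_card_independent) (rule independent_mono[OF indep], auto)
  have sv: "singular_values A = \<sigma> ` B"
  proof
    show "singular_values A \<subseteq> \<sigma> ` B"
    proof
      fix t assume "t \<in> singular_values A"
      then obtain x where "0 \<le> t" "x \<noteq> 0" "x \<in> {x. ?M *v x = t\<^sup>2 *\<^sub>R x}"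
        by (auto simp: singular_values_def)
      then have "{b\<in>B. \<sigma> b = t} \<noteq> {}"
        using eigenspace[of t] by (metis span_empty singletonD)
      then show "t \<in> \<sigma> ` B" by auto
    qed
    show "\<sigma> ` B \<subseteq> singular_values A"
      using pos eig nz unfolding singular_values_def by blast
  qed
  have "nuclear_norm A = (\<Sum>t\<in>\<sigma> ` B. \<Sum>b\<in>{b\<in>B. \<sigma> b = t}. \<sigma> b)"
    unfolding nuclear_norm_def sv using dims pos by (intro sum.cong) auto
  also have "\<dots> = (\<Sum>b\<in>B. \<sigma> b)"
    by (rule sum.image_gen[OF fin, symmetric])
  finally show ?thesis .
qed

lemma Bessel_inequality:
  fixes w :: "'i \<Rightarrow> 'a::real_inner"
  assumes "finite I" and orth: "\<And>i j. i \<in> I \<Longrightarrow> j \<in> I \<Longrightarrow> w i \<bullet> w j = (if i = j then 1 else 0)"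
  shows "(\<Sum>i\<in>I. (w i \<bullet> x)\<^sup>2) \<le> x \<bullet> x"
    and "norm (\<Sum>i\<in>I. c i *\<^sub>R w i) = sqrt (\<Sum>i\<in>I. (c i)\<^sup>2)"
proof -
  have norm_sum: "(\<Sum>i\<in>I. c i *\<^sub>R w i) \<bullet> (\<Sum>i\<in>I. c i *\<^sub>R w i) = (\<Sum>i\<in>I. (c i)\<^sup>2)" for c
  proof -
    have "(\<Sum>i\<in>I. c i *\<^sub>R w i) \<bullet> (\<Sum>i\<in>I. c i *\<^sub>R w i) = (\<Sum>i\<in>I. \<Sum>j\<in>I. c i * (c j * (w i \<bullet> w j)))"
      by (simp add: inner_sum_left inner_sum_right sum_distrib_left inner_commute mult.left_commute)
    also have "\<dots> = (\<Sum>i\<in>I. \<Sum>j\<in>I. if j = i then c i * c j else 0)"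
      using orth by (intro sum.cong) auto
    also have "\<dots> = (\<Sum>i\<in>I. (c i)\<^sup>2)"
      using assms(1) by (simp add: power2_eq_square)
    finally show ?thesis .
  qed
  then show "norm (\<Sum>i\<in>I. c i *\<^sub>R w i) = sqrt (\<Sum>i\<in>I. (c i)\<^sup>2)"
    by (simp add: norm_eq_sqrt_inner)
  let ?p = "\<Sum>i\<in>I. (w i \<bullet> x) *\<^sub>R w i"
  have "0 \<le> (x - ?p) \<bullet> (x - ?p)" by simp
  also have "\<dots> = x \<bullet> x - 2 * (?p \<bullet> x) + ?p \<bullet> ?p"
    by (simp add: inner_diff inner_commute algebra_simps)
  also have "?p \<bullet> x = (\<Sum>i\<in>I. (w i \<bullet> x)\<^sup>2)"
    by (simp add: inner_sum_left power2_eq_square)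
  finally show "(\<Sum>i\<in>I. (w i \<bullet> x)\<^sup>2) \<le> x \<bullet> x"
    by (simp add: norm_sum)
qed

text \<open>Weak duality between nuclear and operator norm: the sum of the rank-one matrices built
  from \<open>u i\<close> and \<open>w i\<close> is a partial isometry. It is proved by expanding
  each \<open>w i\<close> in an eigenbasis of \<open>transpose A ** A\<close>, on which the norms of
  \<open>A *v b\<close> are the singular values.\<close>

lemma sum_inner_le_nuclear_norm:
  fixes A :: "real ^ 'n ^ 'm"
  assumes I: "finite I"
    and u: "\<And>i j. i \<in> I \<Longrightarrow> j \<in> I \<Longrightarrow> u i \<bullet> u j = (if i = j then 1 else 0)"
    and w: "\<And>i j. i \<in> I \<Longrightarrow> j \<in> I \<Longrightarrow> w i \<bullet> w j = (if i = j then 1 else 0)"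
  shows "(\<Sum>i\<in>I. u i \<bullet> (A *v w i)) \<le> nuclear_norm A"
proof -
  let ?M = "transpose A ** A"
  have sym: "(?M *v x) \<bullet> y = x \<bullet> (?M *v y)" for x y
    by (metis dot_lmul_matrix matrix_transpose_mul transpose_transpose vector_transpose_matrix)
  obtain B where orth: "pairwise orthogonal B" and unit: "\<And>b. b \<in> B \<Longrightarrow> norm b = 1"
    and eig: "\<And>b. b \<in> B \<Longrightarrow> \<exists>l. ?M *v b = l *\<^sub>R b" and span: "span B = UNIV"
    using symmetric_orthonormal_eigenbasis[OF matrix_vector_mul_linear sym] by metis
  have sq: "?M *v b = (norm (A *v b))\<^sup>2 *\<^sub>R b" if b: "b \<in> B" for b
  proof -
    obtain l where l: "?M *v b = l *\<^sub>R b" using eig b by blast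
    have "(norm (A *v b))\<^sup>2 = b \<bullet> (?M *v b)"
      unfolding power2_norm_eq_inner
      by (metis dot_lmul_matrix matrix_vector_mul_assoc vector_transpose_matrix inner_commute)
    also have "\<dots> = l" using unit[OF b] l by (simp add: norm_eq_1)
    finally show ?thesis using l by simp
  qed
  have "(\<Sum>i\<in>I. u i \<bullet> (A *v w i)) = (\<Sum>i\<in>I. \<Sum>b\<in>B. (w i \<bullet> b) * (u i \<bullet> (A *v b)))"
  proof (rule sum.cong)
    fix i assume "i \<in> I"
    have "A *v w i = A *v (\<Sum>b\<in>B. (w i \<bullet> b) *\<^sub>R b)"
      using orthonormal_basis_expansion[OF orth unit span, of "w i"] by simp
    also have "\<dots> = (\<Sum>b\<in>B. (w i \<bullet> b) *\<^sub>R (A *v b))"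
      by (simp add: linear_sum[OF matrix_vector_mul_linear] matrix_vector_mult_scaleR)
    finally show "u i \<bullet> (A *v w i) = (\<Sum>b\<in>B. (w i \<bullet> b) * (u i \<bullet> (A *v b)))"
      by (simp add: inner_sum_right)
  qed simp
  also have "\<dots> = (\<Sum>b\<in>B. (\<Sum>i\<in>I. (w i \<bullet> b) *\<^sub>R u i) \<bullet> (A *v b))"
    by (subst sum.swap) (simp add: inner_sum_left)
  also have "\<dots> \<le> (\<Sum>b\<in>B. norm (A *v b))"
  proof (rule sum_mono)
    fix b assume b: "b \<in> B"
    \<comment> \<open>Orthonormality of \<open>u\<close> turns this norm into the root of a sum of
      squared coefficients, which the Bessel inequality for \<open>w\<close> bounds by the norm of
      \<open>b\<close>.\<close>
    have "norm (\<Sum>i\<in>I. (w i \<bullet> b) *\<^sub>R u i) \<le> 1"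
      using Bessel_inequality(2)[OF I u, of "\<lambda>i. w i \<bullet> b"] Bessel_inequality(1)[OF I w, of b] unit[OF b]
      by (simp add: norm_eq_1)
    then have "norm (\<Sum>i\<in>I. (w i \<bullet> b) *\<^sub>R u i) * norm (A *v b) \<le> norm (A *v b)"
      by (intro mult_left_le_one_le) auto
    then show "(\<Sum>i\<in>I. (w i \<bullet> b) *\<^sub>R u i) \<bullet> (A *v b) \<le> norm (A *v b)"
      using norm_cauchy_schwarz order_trans by blast
  qed
  also have "\<dots> = nuclear_norm A"
    by (rule nuclear_norm_eigenbasis[symmetric, OF orth unit span sq]) auto
  finally show ?thesis .
qed

lemma orthogonal_matrix_column_inner:
  fixes U :: "real ^ 'd ^ 'd"
  assumes "orthogonal_matrix U"
  shows "column a U \<bullet> column b U = (if a = b then 1 else 0)"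
  using assms unfolding orthogonal_matrix_orthonormal_columns
  by (auto simp: norm_eq_1 orthogonal_def)

lemma orthogonal_matrix_transpose_mul_column:
  fixes U :: "real ^ 'd ^ 'd"
  assumes "orthogonal_matrix U"
  shows "transpose U *v column a U = axis a 1"
proof (rule vec_eq_iff[THEN iffD2], rule allI)
  fix b
  have "transpose U $ b = column b U" by (simp add: transpose_def column_def)
  then show "(transpose U *v column a U) $ b = axis a 1 $ b"
    unfolding matrix_vector_mul_component by (simp add: orthogonal_matrix_column_inner[OF assms] axis_def)
qed

text \<open>The product is a singular value decomposition: the columns of \<open>R\<close> form an
  orthonormal eigenbasis of \<open>transpose ?A ** ?A\<close> with eigenvalues the squares of the
  entries of \<open>x\<close>.\<close>

lemma nuclear_norm_orthogonal_Diag: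
  fixes U R :: "real ^ 'd ^ 'd"
  assumes U: "orthogonal_matrix U" and R: "orthogonal_matrix R" and x: "\<And>a. 0 \<le> x $ a"
  shows "nuclear_norm (U ** Diag x ** transpose R) = (\<Sum>a\<in>UNIV. x $ a)"
proof -
  let ?A = "U ** Diag x ** transpose R"
  have inj: "inj (\<lambda>a. column a R)"
    by (rule injI) (metis orthogonal_matrix_column_inner[OF R] zero_neq_one)
  define \<sigma> where "\<sigma> b = x $ (inv (\<lambda>a. column a R) b)" for b
  have \<sigma>: "\<sigma> (column a R) = x $ a" for a
    unfolding \<sigma>_def by (simp add: inv_f_f[OF inj])
  note col = orthogonal_matrix_transpose_mul_column[OF R]
  have axisD: "Diag x *v axis a 1 = x $ a *\<^sub>R axis a 1" for a
    unfolding matrix_vector_mult_basis by (simp add: vec_eq_iff column_def Diag_def axis_def)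
  have tD: "transpose (Diag x) = Diag x"
    by (auto simp: transpose_def Diag_def vec_eq_iff)
  have Raxis: "R *v axis a 1 = column a R" for a
    by (rule matrix_vector_mult_basis)
  have "transpose ?A ** ?A = R ** Diag x ** (transpose U ** U) ** Diag x ** transpose R"
    by (simp add: matrix_transpose_mul tD matrix_mul_assoc)
  then have M: "transpose ?A ** ?A = R ** Diag x ** Diag x ** transpose R"
    using U by (simp add: orthogonal_matrix)
  have eig: "(transpose ?A ** ?A) *v column a R = (x $ a)\<^sup>2 *\<^sub>R column a R" for a
    unfolding M
    unfolding matrix_vector_mul_assoc[symmetric] col axisD Raxis matrix_vector_mult_scaleR
    by (simp add: power2_eq_square)
  have orth: "pairwise orthogonal (range (\<lambda>a. column a R))"
    by (auto simp: pairwise_def orthogonal_def orthogonal_matrix_column_inner[OF R] split: if_splits)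
  have unit: "norm b = 1" if "b \<in> range (\<lambda>a. column a R)" for b
    using that by (auto simp: norm_eq_1 orthogonal_matrix_column_inner[OF R])
  have "independent (range (\<lambda>a. column a R))"
    using orthonormal_imp_independent orth unit by blast
  then have "UNIV \<subseteq> span (range (\<lambda>a. column a R))"
    by (intro card_ge_dim_independent) (simp_all add: card_image[OF inj])
  then have span: "span (range (\<lambda>a. column a R)) = UNIV" by auto
  have "nuclear_norm ?A = (\<Sum>b\<in>range (\<lambda>a. column a R). \<sigma> b)"
    using orth unit span by (rule nuclear_norm_eigenbasis) (auto simp: eig \<sigma> x)
  also have "\<dots> = (\<Sum>a\<in>UNIV. x $ a)"
    by (subst sum.reindex[OF inj]) (simp add: \<sigma>)
  finally show ?thesis .
qed

section \<open>Diagonals, pairings and softmax\<close>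

lemma inj_pos: "inj (pos :: 'a::{finite,linorder} \<Rightarrow> nat)"
proof -
  have "pos a < pos b" if "a < b" for a b :: 'a
    unfolding pos_def using that by (intro psubset_card_mono) auto
  then show ?thesis
    by (intro injI) (metis less_irrefl linorder_less_linear)
qed

lemma pos_eq_iff [simp]: "pos a = pos b \<longleftrightarrow> a = b"
  using inj_pos by (auto dest: injD)

lemma range_pos: "range (pos :: 'a::{finite,linorder} \<Rightarrow> nat) = {..<CARD('a)}"
proof (rule card_subset_eq)
  have "pos a < CARD('a)" for a :: 'a
    unfolding pos_def by (intro psubset_card_mono) auto
  then show "range (pos :: 'a \<Rightarrow> nat) \<subseteq> {..<CARD('a)}" by auto
qed (auto simp: card_image[OF inj_pos])

lemma ex_pos_eq:
  assumes "CARD('d::{finite,linorder}) \<le> CARD('e::{finite,linorder})"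
  shows "\<exists>b::'e. pos b = pos (a::'d)"
proof -
  have "pos a \<in> {..<CARD('d)}" unfolding range_pos[symmetric] by simp
  then have "pos a \<in> range (pos :: 'e \<Rightarrow> nat)" unfolding range_pos using assms by simp
  then show ?thesis by (metis imageE)
qed

lemma diagonal_of_nth:
  assumes "pos b = pos a"
  shows "diagonal_of A $ a = A $ a $ b"
proof -
  have "(THE b'. pos b' = pos a) = b"
    using assms by (intro the_equality) (auto simp flip: assms)
  then show ?thesis by (simp add: diagonal_of_def)
qed

text \<open>A partition into pairs is recast as an involution fixing \<open>c\<close>, so that sums
  over tokens can be reindexed by a bijection. Symmetry of \<open>R\<close> is needed because the
  two members of a block come in no particular order.\<close>

lemma involution_of_pairs:
  assumes P: "partition_on (UNIV - {c}) P"
    and pairs: "\<And>p. p \<in> P \<Longrightarrow> \<exists>l l'. l \<noteq> l' \<and> p = {l, l'} \<and> R l l'"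
    and sym: "\<And>l l'. R l l' \<Longrightarrow> R l' l"
  obtains \<tau> where "\<tau> c = c" "\<And>l. \<tau> (\<tau> l) = l" "\<And>l. l \<noteq> c \<Longrightarrow> R l (\<tau> l)"
proof -
  have "\<exists>l'. l' \<noteq> l \<and> {l, l'} \<in> P \<and> R l l'" if l: "l \<noteq> c" for l
  proof -
    obtain p where p: "p \<in> P" "l \<in> p" using P l by (auto simp: partition_on_def)
    obtain m m' where m: "m \<noteq> m'" "p = {m, m'}" "R m m'" using pairs[OF p(1)] by blast
    then show ?thesis using p sym[OF m(3)] by (metis insertE insert_commute singletonD)
  qed
  then obtain f where f: "\<And>l. l \<noteq> c \<Longrightarrow> f l \<noteq> l \<and> {l, f l} \<in> P \<and> R l (f l)" by metis
  define \<tau> where "\<tau> l = (if l = c then c else f l)" for l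
  have "f l \<noteq> c" if "l \<noteq> c" for l
    using f[OF that] P by (auto simp: partition_on_def)
  moreover have "f (f l) = l" if "l \<noteq> c" "f l \<noteq> c" for l
  proof -
    \<comment> \<open>Both blocks contain \<open>f l\<close>, and distinct blocks of a partition are
      disjoint.\<close>
    have "{l, f l} = {f l, f (f l)}"
      using f[OF that(1)] f[OF that(2)] partition_onD2[OF P]
      unfolding disjoint_def by (metis Int_iff insertCI empty_iff)
    then show ?thesis using f[OF that(2)] by (auto simp: doubleton_eq_iff)
  qed
  ultimately have "\<tau> (\<tau> l) = l" for l by (simp add: \<tau>_def)
  then show thesis using f by (intro that[of \<tau>]) (auto simp: \<tau>_def)
qed

section \<open>Bounds and derivative of softmax\<close>

lemma softmax_nonneg: "0 \<le> softmax x $ l"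
  by (simp add: softmax_def sum_nonneg)

lemma sum_exp_pos: "0 < (\<Sum>m\<in>UNIV. exp (x $ m :: real))" for x :: "real ^ 'l::finite"
  by (intro sum_pos) auto

lemma sum_softmax: "(\<Sum>l\<in>UNIV. softmax x $ l) = 1"
  using sum_exp_pos[of x] by (simp add: softmax_def flip: sum_divide_distrib)

lemma softmax_le_1: "softmax x $ l \<le> 1"
  using sum_softmax[of x] member_le_sum[of l UNIV "\<lambda>l. softmax x $ l"] by (simp add: softmax_nonneg)

lemma abs_exp_diff_le:
  fixes a b :: real
  shows "\<bar>exp a - exp b\<bar> \<le> max (exp a) (exp b) * \<bar>a - b\<bar>"
proof (induction a b rule: linorder_wlog)
  case (le a b)
  have "exp b * (1 + (a - b)) \<le> exp b * exp (a - b)"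
    by (intro mult_left_mono exp_ge_add_one_self) auto
  also have "\<dots> = exp a" by (simp flip: exp_add)
  finally show ?case using le by (simp add: algebra_simps max_def)
qed (simp add: abs_minus_commute max.commute)

text \<open>The normalising sum dominates both exponentials, so it absorbs the factor
  \<open>max\<close> in \<open>abs_exp_diff_le\<close>. The bound lets close logits within a pair
  force close softmax weights.\<close>

lemma abs_softmax_diff_le: "\<bar>softmax x $ l - softmax x $ m\<bar> \<le> \<bar>x $ l - x $ m\<bar>"
proof -
  let ?S = "\<Sum>m\<in>UNIV. exp (x $ m)"
  have "exp (x $ l) \<le> ?S" for l
    by (rule member_le_sum) auto
  then have "max (exp (x $ l)) (exp (x $ m)) * \<bar>x $ l - x $ m\<bar> \<le> ?S * \<bar>x $ l - x $ m\<bar>"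
    by (intro mult_right_mono) auto
  then have "\<bar>exp (x $ l) - exp (x $ m)\<bar> \<le> ?S * \<bar>x $ l - x $ m\<bar>"
    using abs_exp_diff_le order_trans by blast
  then have "\<bar>exp (x $ l) - exp (x $ m)\<bar> / ?S \<le> \<bar>x $ l - x $ m\<bar>"
    using sum_exp_pos[of x] by (simp add: divide_le_eq mult.commute)
  moreover have "\<bar>softmax x $ l - softmax x $ m\<bar> = \<bar>exp (x $ l) - exp (x $ m)\<bar> / ?S"
    using sum_exp_pos[of x] by (simp add: softmax_def flip: diff_divide_distrib)
  ultimately show ?thesis by simp
qed

lemma has_derivative_softmax_nth:
  "((\<lambda>x. softmax x $ l) has_derivative
    (\<lambda>h. softmax x $ l * (h $ l - (\<Sum>m\<in>UNIV. softmax x $ m * h $ m)))) (at x)"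
proof -
  let ?S = "\<lambda>x. \<Sum>m\<in>UNIV. exp (x $ m)"
  have S: "?S x \<noteq> 0" using sum_exp_pos[of x] by simp
  have nth: "((\<lambda>x. x $ m) has_derivative (\<lambda>h. h $ m)) (at x)" for m
    by (rule bounded_linear.has_derivative[OF bounded_linear_vec_nth has_derivative_ident])
  have "((\<lambda>x. exp (x $ l) / ?S x) has_derivative
    (\<lambda>h. ((exp (x $ l) * h $ l) * ?S x - exp (x $ l) * (\<Sum>m\<in>UNIV. exp (x $ m) * h $ m)) / (?S x * ?S x))) (at x)"
    using S by (auto intro!: derivative_eq_intros nth simp: fun_eq_iff mult.commute)
  moreover have "((exp (x $ l) * h $ l) * ?S x - exp (x $ l) * (\<Sum>m\<in>UNIV. exp (x $ m) * h $ m)) / (?S x * ?S x)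
     = softmax x $ l * (h $ l - (\<Sum>m\<in>UNIV. softmax x $ m * h $ m))" for h
  proof -
    have "(\<Sum>m\<in>UNIV. softmax x $ m * h $ m) = (\<Sum>m\<in>UNIV. exp (x $ m) * h $ m) / ?S x"
      by (simp add: softmax_def sum_divide_distrib)
    then show ?thesis using S by (simp add: softmax_def field_simps)
  qed
  ultimately show ?thesis by (simp add: softmax_def)
qed

section \<open>Rank-one matrices and gradients of softmax losses\<close>

definition outer :: "real ^ 'd \<Rightarrow> real ^ 'e \<Rightarrow> real ^ 'e ^ 'd" where
  "outer p q = (\<chi> a c. p $ a * q $ c)"

lemma inner_outer: "A \<bullet> outer p q = p \<bullet> (A *v q)"
  by (simp add: outer_def inner_vec_def matrix_vector_mult_def sum_distrib_left algebra_simps)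

lemma outer_linear_combination:
  "outer (r *\<^sub>R (p - (\<Sum>m\<in>S. s m *\<^sub>R f m))) q = r *\<^sub>R (outer p q - (\<Sum>m\<in>S. s m *\<^sub>R outer (f m) q))"
  "outer q (r *\<^sub>R (p - (\<Sum>m\<in>S. s m *\<^sub>R f m))) = r *\<^sub>R (outer q p - (\<Sum>m\<in>S. s m *\<^sub>R outer q (f m)))"
  by (simp_all add: outer_def vec_eq_iff algebra_simps sum_distrib_left sum_distrib_right)

lemma matrix_mul_outer: "A ** outer p q = outer (A *v p) q"
  by (simp add: outer_def vec_eq_iff matrix_matrix_mult_def matrix_vector_mult_def sum_distrib_right mult.assoc)

lemma outer_matrix_mul: "outer p q ** A = outer p (transpose A *v q)"
  by (simp add: outer_def vec_eq_iff matrix_matrix_mult_def matrix_vector_mult_def transpose_def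
      sum_distrib_left algebra_simps)

text \<open>The scalar chain-rule factor: the derivative of the exponential, up to sign, times the
  factor \<open>softmax w $ k\<close> of the softmax derivative.\<close>

definition risk_weight :: "real \<Rightarrow> real \<Rightarrow> real ^ 'l \<Rightarrow> 'l \<Rightarrow> real" where
  "risk_weight g \<Delta> w k = exp (- (g + \<Delta> * softmax w $ k)) * \<Delta> * softmax w $ k"

text \<open>Stated for logits that are arbitrary linear functionals \<open>A \<bullet> M l\<close>,
  so that it serves for both the key and the query matrix, with \<open>M l\<close> a rank-one matrix
  in either case.\<close>

lemma GDERIV_exp_softmax:
  fixes M :: "'l::finite \<Rightarrow> 'a::real_inner"
  shows "GDERIV (\<lambda>A. exp (- (g + \<Delta> * softmax (\<chi> l. A \<bullet> M l) $ k))) A :>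
    - (risk_weight g \<Delta> (\<chi> l. A \<bullet> M l) k *\<^sub>R (M k - (\<Sum>m\<in>UNIV. softmax (\<chi> l. A \<bullet> M l) $ m *\<^sub>R M m)))"
proof -
  let ?w = "\<lambda>A. \<chi> l. A \<bullet> M l"
  have w: "(?w has_derivative ?w) (at A)"
    unfolding has_derivative_componentwise_within[of ?w]
    by (auto simp: Basis_vec_def inner_axis intro!: derivative_eq_intros)
  have "((\<lambda>A. softmax (?w A) $ k) has_derivative
      (\<lambda>h. softmax (?w A) $ k * (?w h $ k - (\<Sum>m\<in>UNIV. softmax (?w A) $ m * ?w h $ m)))) (at A)"
    by (rule has_derivative_compose[OF w has_derivative_softmax_nth])
  then have "((\<lambda>A. exp (- (g + \<Delta> * softmax (?w A) $ k))) has_derivative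
      (\<lambda>h. exp (- (g + \<Delta> * softmax (?w A) $ k)) * (- (\<Delta> *
        (softmax (?w A) $ k * (?w h $ k - (\<Sum>m\<in>UNIV. softmax (?w A) $ m * ?w h $ m))))))) (at A)"
    by (auto intro!: derivative_eq_intros)
  moreover have "exp (- (g + \<Delta> * softmax (?w A) $ k)) * (- (\<Delta> *
        (softmax (?w A) $ k * (?w h $ k - (\<Sum>m\<in>UNIV. softmax (?w A) $ m * ?w h $ m)))))
     = h \<bullet> - (risk_weight g \<Delta> (?w A) k *\<^sub>R (M k - (\<Sum>m\<in>UNIV. softmax (?w A) $ m *\<^sub>R M m)))" for h
    by (simp add: risk_weight_def inner_diff_right inner_sum_right)
  ultimately show ?thesis by (simp add: gderiv_def)
qed

lemma GDERIV_sum: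
  assumes "finite I" "\<And>i. i \<in> I \<Longrightarrow> GDERIV (f i) x :> G i"
  shows "GDERIV (\<lambda>x. \<Sum>i\<in>I. f i x) x :> (\<Sum>i\<in>I. G i)"
  using assms unfolding gderiv_def inner_sum_right by (intro has_derivative_sum) auto

section \<open>Scalar differential inequalities\<close>

text \<open>The derivative is taken within \<open>{0..}\<close>, as in the gradient flow; it is
  two-sided at interior points, and at 0 only continuity is needed.\<close>

lemma nondecreasing_halfline:
  fixes f :: "real \<Rightarrow> real"
  assumes f: "\<And>t. 0 \<le> t \<Longrightarrow> (f has_real_derivative f' t) (at t within {0..})"
    and nonneg: "\<And>t. 0 < t \<Longrightarrow> t < b \<Longrightarrow> 0 \<le> f' t" and b: "0 \<le> b"
  shows "f 0 \<le> f b"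
proof (rule DERIV_nonneg_imp_increasing_open[OF b])
  fix t :: real assume t: "0 < t" "t < b"
  then have "at t within {0..} = at t"
    by (intro at_within_interior) simp
  then show "\<exists>y. (f has_real_derivative y) (at t) \<and> 0 \<le> y"
    using f[of t] nonneg[of t] t by auto
next
  show "continuous_on {0..b} f"
    by (intro DERIV_continuous_on[of "{0..b}" f f'] has_field_derivative_subset[OF f]) auto
qed

text \<open>The function \<open>D t * exp (- C * t)\<close> is nonincreasing on the interval and
  starts at 0.\<close>

lemma Gronwall_zero:
  fixes D :: "real \<Rightarrow> real"
  assumes D: "\<And>t. 0 \<le> t \<Longrightarrow> (D has_real_derivative D' t) (at t within {0..})"
    and bound: "\<And>t. 0 \<le> t \<Longrightarrow> t \<le> b \<Longrightarrow> D' t \<le> C * D t"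
    and D0: "D 0 = 0" and nonneg: "0 \<le> D b" and b: "0 \<le> b"
  shows "D b = 0"
proof -
  have "- (D 0 * exp (- C * 0)) \<le> - (D b * exp (- C * b))"
  proof (rule nondecreasing_halfline[where f = "\<lambda>t. - (D t * exp (- C * t))"])
    fix t :: real assume "0 \<le> t"
    then show "((\<lambda>t. - (D t * exp (- C * t))) has_real_derivative exp (- C * t) * (C * D t - D' t)) (at t within {0..})"
      by (auto intro!: derivative_eq_intros D simp: algebra_simps)
  qed (use bound b in auto)
  then have "D b \<le> 0" using D0 by (simp add: mult_le_0_iff)
  then show ?thesis using nonneg by simp
qed

text \<open>The derivative of \<open>exp (y t)\<close> is at least \<open>c\<close> and at most
  \<open>C * (1 + y t)\<close>. Integrating gives \<open>ln (1 + c * t) \<le> y t\<close> and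
  \<open>y t - ln (1 + y t) \<le> ln (1 + C * t)\<close>; since \<open>y\<close> tends to infinity,
  \<open>ln (1 + y t)\<close> is negligible against \<open>y t\<close>.\<close>

lemma logarithmic_growth:
  fixes y :: "real \<Rightarrow> real"
  assumes y: "\<And>t. 0 \<le> t \<Longrightarrow> (y has_real_derivative y' t) (at t within {0..})"
    and y0: "y 0 = 0" and nonneg: "\<And>t. 0 \<le> t \<Longrightarrow> 0 \<le> y t" and c: "0 < c"
    and lower: "\<And>t. 0 \<le> t \<Longrightarrow> c * exp (- y t) \<le> y' t"
    and upper: "\<And>t. 0 \<le> t \<Longrightarrow> y' t \<le> C * (1 + y t) * exp (- y t)"
  shows "((\<lambda>t. y t / ln t) \<longlongrightarrow> 1) at_top"
proof -
  have "0 < c" by fact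
  also have "c \<le> C" using lower[of 0] upper[of 0] y0 by simp
  finally have C: "0 < C" .
  have low: "ln (1 + c * t) \<le> y t" if t: "0 \<le> t" for t
  proof -
    have "exp (y 0) - c * 0 \<le> exp (y t) - c * t"
    proof (rule nondecreasing_halfline[where f = "\<lambda>t. exp (y t) - c * t"])
      fix t :: real assume "0 \<le> t"
      then show "((\<lambda>t. exp (y t) - c * t) has_real_derivative exp (y t) * y' t - c) (at t within {0..})"
        by (auto intro!: derivative_eq_intros y)
    next
      fix t :: real assume "0 < t"
      then have "exp (y t) * (c * exp (- y t)) \<le> exp (y t) * y' t"
        by (intro mult_left_mono lower) auto
      also have "exp (y t) * (c * exp (- y t)) = c" by (simp add: exp_minus)
      finally show "0 \<le> exp (y t) * y' t - c" by simp
    qed (use t in auto)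
    then have "1 + c * t \<le> exp (y t)" using y0 by simp
    moreover have "0 < 1 + c * t" using c t by (simp add: add_pos_nonneg)
    ultimately show ?thesis by (metis ln_exp ln_le_cancel_iff exp_gt_zero)
  qed
  have up: "y t - ln (1 + y t) \<le> ln (1 + C * t)" if t: "0 \<le> t" for t
  proof -
    \<comment> \<open>Dividing \<open>exp (y t)\<close> by \<open>1 + y t\<close> absorbs the linear
      factor of the upper bound: the derivative of the quotient is at most
      \<open>C * y t / (1 + y t)\<close>, hence at most \<open>C\<close>.\<close>
    have "C * 0 - exp (y 0) / (1 + y 0) \<le> C * t - exp (y t) / (1 + y t)"
    proof (rule nondecreasing_halfline[where f = "\<lambda>t. C * t - exp (y t) / (1 + y t)"])
      fix t :: real assume t: "0 \<le> t"
      then have "1 + y t \<noteq> 0" using nonneg[of t] by simp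
      then show "((\<lambda>t. C * t - exp (y t) / (1 + y t)) has_real_derivative
          C - exp (y t) * y t * y' t / ((1 + y t) * (1 + y t))) (at t within {0..})"
        using t by (auto intro!: derivative_eq_intros y simp: field_simps)
    next
      fix t :: real assume "0 < t"
      then have t: "0 \<le> t" by simp
      note n = nonneg[OF t]
      have "exp (y t) * y t * y' t \<le> exp (y t) * y t * (C * (1 + y t) * exp (- y t))"
        using n upper[OF t] by (intro mult_left_mono) auto
      also have "\<dots> = C * (1 + y t) * y t" by (simp add: exp_minus)
      also have "\<dots> \<le> C * (1 + y t) * (1 + y t)" using n C by (intro mult_left_mono) auto
      finally have "exp (y t) * y t * y' t \<le> C * ((1 + y t) * (1 + y t))" by simp
      then show "0 \<le> C - exp (y t) * y t * y' t / ((1 + y t) * (1 + y t))"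
        using n by (simp add: divide_le_eq)
    qed (use t in auto)
    then have "exp (y t) / (1 + y t) \<le> 1 + C * t" using y0 by simp
    moreover have "0 < 1 + C * t" "0 < 1 + y t"
      using C t nonneg[OF t] by (simp_all add: add_pos_nonneg)
    ultimately have "ln (exp (y t) / (1 + y t)) \<le> ln (1 + C * t)"
      by (subst ln_le_cancel_iff) auto
    then show ?thesis using \<open>0 < 1 + y t\<close> by (simp add: ln_div)
  qed
  have "filterlim (\<lambda>t. ln (1 + c * t)) at_top at_top"
    using c by real_asymp
  moreover have "eventually (\<lambda>t. ln (1 + c * t) \<le> y t) at_top"
    using eventually_ge_at_top[of 0] by eventually_elim (rule low)
  ultimately have ytop: "filterlim y at_top at_top"
    by (rule filterlim_at_top_mono)
  have "((\<lambda>u::real. (u - ln (1 + u)) / u) \<longlongrightarrow> 1) at_top"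
    by real_asymp
  then have quot: "((\<lambda>t. (y t - ln (1 + y t)) / y t) \<longlongrightarrow> 1) at_top"
    using ytop by (rule filterlim_compose)
  have lim1: "((\<lambda>t. ln (1 + c * t) / ln t) \<longlongrightarrow> 1) at_top"
    using c by real_asymp
  have "((\<lambda>t. ln (1 + C * t) / ln t) \<longlongrightarrow> 1) at_top"
    using C by real_asymp
  from tendsto_divide[OF this quot]
  have lim2: "((\<lambda>t. ln (1 + C * t) / ln t / ((y t - ln (1 + y t)) / y t)) \<longlongrightarrow> 1) at_top"
    by simp
  show ?thesis
  proof (rule tendsto_sandwich[OF _ _ lim1 lim2])
    show "\<forall>\<^sub>F t in at_top. ln (1 + c * t) / ln t \<le> y t / ln t"
      using eventually_gt_at_top[of 1] by eventually_elim (auto intro!: divide_right_mono low)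
    have "\<forall>\<^sub>F t in at_top. 0 < (y t - ln (1 + y t)) / y t"
      using order_tendstoD(1)[OF quot, of 0] by simp
    moreover have "\<forall>\<^sub>F t in at_top. 0 < y t"
      using ytop by (simp add: filterlim_at_top_dense)
    ultimately show "\<forall>\<^sub>F t in at_top. y t / ln t \<le> ln (1 + C * t) / ln t / ((y t - ln (1 + y t)) / y t)"
      using eventually_gt_at_top[of 1]
    proof eventually_elim
      fix t :: real assume t: "0 < (y t - ln (1 + y t)) / y t" "0 < y t" "1 < t"
      then have "y t / ln t * ((y t - ln (1 + y t)) / y t) \<le> ln (1 + C * t) / ln t"
        using up[of t] by (simp add: divide_right_mono)
      then show "y t / ln t \<le> ln (1 + C * t) / ln t / ((y t - ln (1 + y t)) / y t)"
        using t(1) by (subst pos_le_divide_eq)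
    qed
  qed
qed

text \<open>The product \<open>k q\<close> has derivative \<open>g * (k^2 + q^2)\<close>, and
  \<open>k^2 - q^2\<close> is conserved. The identity
  \<open>(k^2 + q^2)^2 = (k^2 - q^2)^2 + 4 (k q)^2\<close> therefore expresses the unknown factor
  through the product alone.\<close>

lemma balanced_product_growth:
  fixes k q g :: "real \<Rightarrow> real"
  assumes k: "\<And>t. 0 \<le> t \<Longrightarrow> (k has_real_derivative g t * q t) (at t within {0..})"
    and q: "\<And>t. 0 \<le> t \<Longrightarrow> (q has_real_derivative g t * k t) (at t within {0..})"
    and init: "k 0 * q 0 = 0" "(k 0)\<^sup>2 + (q 0)\<^sup>2 = 2 * \<omega>\<^sup>2" "\<omega> \<noteq> 0"
    and g: "\<And>t. 0 \<le> t \<Longrightarrow> 0 \<le> g t" and pos: "0 < lo" "0 < r"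
    and lower: "\<And>t. 0 \<le> t \<Longrightarrow> 0 \<le> k t * q t \<Longrightarrow> lo * exp (- (r * (k t * q t))) \<le> g t"
    and upper: "\<And>t. 0 \<le> t \<Longrightarrow> 0 \<le> k t * q t \<Longrightarrow> g t \<le> hi * exp (- (r * (k t * q t)))"
  shows "\<And>t. 0 \<le> t \<Longrightarrow> 0 \<le> k t * q t"
    and "((\<lambda>t. r * (k t * q t) / ln t) \<longlongrightarrow> 1) at_top"
proof -
  let ?P = "\<lambda>t. (k t)\<^sup>2 + (q t)\<^sup>2" and ?b = "\<lambda>t. k t * q t"
  have b': "(?b has_real_derivative g t * ?P t) (at t within {0..})" if "0 \<le> t" for t
    using that by (auto intro!: derivative_eq_intros k q simp: power2_eq_square algebra_simps)
  show b: "0 \<le> ?b t" if t: "0 \<le> t" for t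
  proof -
    have "?b 0 \<le> ?b t"
      by (rule nondecreasing_halfline[OF b']) (use g t in auto)
    then show ?thesis using init by simp
  qed
  have P2: "(?P t)\<^sup>2 = 4 * (\<omega>\<^sup>2)\<^sup>2 + 4 * (?b t)\<^sup>2" if t: "0 \<le> t" for t
  proof -
    have der: "((\<lambda>t. (k t)\<^sup>2 - (q t)\<^sup>2) has_real_derivative 0) (at t within {0..})" if "0 \<le> t" for t
      using that by (auto intro!: derivative_eq_intros k q simp: algebra_simps)
    have "(k t)\<^sup>2 - (q t)\<^sup>2 = (k 0)\<^sup>2 - (q 0)\<^sup>2"
      \<comment> \<open>A function with zero derivative is constant because it and its negative are
        both nondecreasing.\<close>
      using nondecreasing_halfline[OF der _ t] nondecreasing_halfline[OF DERIV_minus[OF der] _ t] by simp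
    then have "((k t)\<^sup>2 - (q t)\<^sup>2)\<^sup>2 = ((k 0)\<^sup>2 - (q 0)\<^sup>2)\<^sup>2" by simp
    also have "\<dots> = (?P 0)\<^sup>2 - 4 * (?b 0)\<^sup>2"
      by (simp add: power2_eq_square algebra_simps)
    finally have "((k t)\<^sup>2 - (q t)\<^sup>2)\<^sup>2 = (?P 0)\<^sup>2 - 4 * (?b 0)\<^sup>2" .
    then have "((k t)\<^sup>2 - (q t)\<^sup>2)\<^sup>2 = 4 * (\<omega>\<^sup>2)\<^sup>2" using init by (simp add: power_mult_distrib)
    then show ?thesis by (simp add: power2_eq_square algebra_simps)
  qed
  have P: "2 * \<omega>\<^sup>2 \<le> ?P t" "?P t \<le> 2 * \<omega>\<^sup>2 + 2 * ?b t" if t: "0 \<le> t" for t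
  proof -
    show "2 * \<omega>\<^sup>2 \<le> ?P t"
      by (rule power2_le_imp_le) (use P2[OF t] in \<open>auto simp: power_mult_distrib\<close>)
    \<comment> \<open>This is the excess of \<open>(2 * \<omega>\<^sup>2 + 2 * ?b t)\<^sup>2\<close>
      over \<open>(?P t)\<^sup>2\<close>.\<close>
    have "0 \<le> 8 * (\<omega>\<^sup>2 * ?b t)" using b[OF t] by simp
    then have "(?P t)\<^sup>2 \<le> (2 * \<omega>\<^sup>2 + 2 * ?b t)\<^sup>2"
      unfolding P2[OF t] by (simp add: power2_sum power_mult_distrib)
    then show "?P t \<le> 2 * \<omega>\<^sup>2 + 2 * ?b t"
      by (rule power2_le_imp_le) (use b[OF t] in auto)
  qed
  have hi: "0 \<le> hi"
    using g[of 0] upper[of 0] init by simp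
  \<comment> \<open>Apply \<open>logarithmic_growth\<close> to \<open>r * ?b t\<close>. The constant
    \<open>c\<close> comes from \<open>?P t \<ge> 2 * \<omega>\<^sup>2\<close>; the constant
    \<open>C\<close> from \<open>2 * r * \<omega>\<^sup>2 + 2 * u \<le> (2 * r * \<omega>\<^sup>2 +
    2) * (1 + u)\<close> with \<open>u = r * ?b t\<close>.\<close>
  show "((\<lambda>t. r * ?b t / ln t) \<longlongrightarrow> 1) at_top"
  proof (rule logarithmic_growth[where y' = "\<lambda>t. r * (g t * ?P t)" and c = "r * (lo * (2 * \<omega>\<^sup>2))"
        and C = "hi * (2 * r * \<omega>\<^sup>2 + 2)"])
    fix t :: real assume t: "0 \<le> t"
    show "((\<lambda>t. r * ?b t) has_real_derivative r * (g t * ?P t)) (at t within {0..})"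
      by (rule DERIV_cmult[OF b'[OF t]])
    show "0 \<le> r * ?b t" using b[OF t] pos by simp
    have "lo * exp (- (r * ?b t)) * (2 * \<omega>\<^sup>2) \<le> g t * ?P t"
      using lower[OF t b[OF t]] P(1)[OF t] g[OF t] by (intro mult_mono) auto
    then show "r * (lo * (2 * \<omega>\<^sup>2)) * exp (- (r * ?b t)) \<le> r * (g t * ?P t)"
      using pos by (simp add: mult_ac)
    have "g t * ?P t \<le> hi * exp (- (r * ?b t)) * (2 * \<omega>\<^sup>2 + 2 * ?b t)"
      using upper[OF t b[OF t]] P(2)[OF t] hi by (intro mult_mono) auto
    then have "r * (g t * ?P t) \<le> r * (hi * exp (- (r * ?b t)) * (2 * \<omega>\<^sup>2 + 2 * ?b t))"
      using pos by (intro mult_left_mono) auto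
    also have "\<dots> = hi * exp (- (r * ?b t)) * (2 * r * \<omega>\<^sup>2 + 2 * (r * ?b t))"
      by (simp add: algebra_simps)
    also have "\<dots> \<le> hi * exp (- (r * ?b t)) * ((2 * r * \<omega>\<^sup>2 + 2) * (1 + r * ?b t))"
    proof (rule mult_left_mono)
      have "0 \<le> 2 * r * \<omega>\<^sup>2 * (r * ?b t)" using pos b[OF t] by simp
      then show "2 * r * \<omega>\<^sup>2 + 2 * (r * ?b t) \<le> (2 * r * \<omega>\<^sup>2 + 2) * (1 + r * ?b t)"
        by (simp add: algebra_simps)
    qed (use hi in simp)
    finally show "r * (g t * ?P t) \<le> hi * (2 * r * \<omega>\<^sup>2 + 2) * (1 + r * ?b t) * exp (- (r * ?b t))"
      by (simp add: algebra_simps)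
  qed (use pos init in auto)
qed

section \<open>The flow in aligned coordinates\<close>

text \<open>
  Here \<open>A\<close>, \<open>B\<close> stand for \<open>\<Lambda>K\<close>, \<open>\<Lambda>Q\<close>, the tokens \<open>x i l\<close> are expressed in the basis \<open>UK\<close>, and the vector \<open>z i\<close>
  has become \<open>\<rho> i\<close> times the unit vector with index \<open>\<pi> i\<close>.  The involution \<open>\<tau> i\<close> exchanges the two tokens of
  each pair, \<open>m\<close> is the factor \<open>1 / n\<close> of the loss, \<open>g i\<close> the non-optimal score and \<open>\<Delta> i\<close> the score gap.
\<close>

locale aligned_attention_flow =
  fixes x :: "'n::finite \<Rightarrow> 'l::finite \<Rightarrow> real ^ 'd::{finite,linorder}"
    and opt :: "'n \<Rightarrow> 'l" and \<tau> :: "'n \<Rightarrow> 'l \<Rightarrow> 'l" and c :: "'n \<Rightarrow> 'l \<Rightarrow> real"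
    and \<pi> :: "'n \<Rightarrow> 'd" and N \<rho> g \<Delta> :: "'n \<Rightarrow> real" and m :: real
    and A B :: "real \<Rightarrow> real ^ 'e::{finite,linorder} ^ 'd::{finite,linorder}"
    and logits :: "'n \<Rightarrow> real \<Rightarrow> real ^ 'l" and force :: "'n \<Rightarrow> real \<Rightarrow> real ^ 'd::{finite,linorder}"
  assumes inj: "inj \<pi>" and N: "0 < N i" and \<rho>: "0 < \<rho> i" and \<Delta>: "0 < \<Delta> i" and m: "0 < m"
    and x_opt: "x i (opt i) = N i *\<^sub>R axis (\<pi> i) 1"
    and \<tau>_opt: "\<tau> i (opt i) = opt i" and \<tau>_\<tau>: "\<tau> i (\<tau> i l) = l"
    and pair: "x i l + x i (\<tau> i l) = (2 * c i l * N i) *\<^sub>R axis (\<pi> i) 1"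
    and x_\<pi>: "x i l $ \<pi> i = c i l * N i"
    and c: "-1 \<le> c i l" "l \<noteq> opt i \<Longrightarrow> c i l < 1"
    and nonopt: "\<exists>l. l \<noteq> opt i"
    and dims: "CARD('d) \<le> CARD('e)"
    and logits: "logits i t = (\<chi> l. \<rho> i * (x i l \<bullet> (A t *v (B t $ \<pi> i))))"
    and force: "force i t = (m * risk_weight (g i) (\<Delta> i) (logits i t) (opt i)) *\<^sub>R
          (x i (opt i) - (\<Sum>l\<in>UNIV. softmax (logits i t) $ l *\<^sub>R x i l))"
    and flow: "0 \<le> t \<Longrightarrow> (A has_vector_derivative
          (\<Sum>i\<in>UNIV. outer (force i t) (\<rho> i *\<^sub>R B t $ \<pi> i))) (at t within {0..})"
        "0 \<le> t \<Longrightarrow> (B has_vector_derivative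
          (\<Sum>i\<in>UNIV. outer (\<rho> i *\<^sub>R axis (\<pi> i) 1) (transpose (A t) *v force i t))) (at t within {0..})"
    and init: "diagonal_matrix (A 0)" "diagonal_matrix (B 0)"
begin

abbreviation s :: "'n \<Rightarrow> real \<Rightarrow> 'l \<Rightarrow> real" where
  "s i t l \<equiv> softmax (logits i t) $ l"

definition weight :: "'n \<Rightarrow> real \<Rightarrow> real" where
  "weight i t = m * risk_weight (g i) (\<Delta> i) (logits i t) (opt i)"

lemma force_nth: "force i t $ a = weight i t * (x i (opt i) $ a - (\<Sum>l\<in>UNIV. s i t l * x i l $ a))"
  by (simp add: force weight_def sum_component)

definition dA :: "real \<Rightarrow> 'd \<Rightarrow> 'e \<Rightarrow> real" where
  "dA t a b = (\<Sum>i\<in>UNIV. force i t $ a * (\<rho> i * B t $ \<pi> i $ b))"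

definition dB :: "real \<Rightarrow> 'd \<Rightarrow> 'e \<Rightarrow> real" where
  "dB t a b = (\<Sum>i\<in>UNIV. if a = \<pi> i then \<rho> i * (\<Sum>a'\<in>UNIV. A t $ a' $ b * force i t $ a') else 0)"

lemma derivs:
  assumes "0 \<le> t"
  shows A_deriv: "((\<lambda>t. A t $ a $ b) has_real_derivative dA t a b) (at t within {0..})"
    and B_deriv: "((\<lambda>t. B t $ a $ b) has_real_derivative dB t a b) (at t within {0..})"
proof -
  have nth: "bounded_linear (\<lambda>M :: real ^ 'e::{finite,linorder} ^ 'd::{finite,linorder}. M $ a $ b)"
    using bounded_linear_compose[OF bounded_linear_vec_nth bounded_linear_vec_nth] .
  show "((\<lambda>t. A t $ a $ b) has_real_derivative dA t a b) (at t within {0..})"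
    using bounded_linear.has_vector_derivative[OF nth flow(1)[OF assms]]
    by (simp add: has_real_derivative_iff_has_vector_derivative dA_def outer_def)
  have "(\<Sum>i\<in>UNIV. outer (\<rho> i *\<^sub>R axis (\<pi> i) 1) (transpose (A t) *v force i t)) $ a $ b = dB t a b"
    by (auto simp: dB_def outer_def axis_def matrix_vector_mult_def transpose_def intro!: sum.cong)
  then show "((\<lambda>t. B t $ a $ b) has_real_derivative dB t a b) (at t within {0..})"
    using bounded_linear.has_vector_derivative[OF nth flow(2)[OF assms]]
    by (simp add: has_real_derivative_iff_has_vector_derivative)
qed

lemma weight_bounds: "0 \<le> weight i t" "weight i t \<le> m * (exp (- g i) * \<Delta> i)"
proof -
  show "0 \<le> weight i t"
    using \<Delta>[of i] m by (simp add: weight_def risk_weight_def softmax_nonneg)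
  have "exp (- (g i + \<Delta> i * s i t (opt i))) * \<Delta> i * s i t (opt i) \<le> (exp (- g i) * \<Delta> i) * 1"
    using \<Delta>[of i] softmax_nonneg softmax_le_1 by (intro mult_mono) auto
  then show "weight i t \<le> m * (exp (- g i) * \<Delta> i)"
    using m by (simp add: weight_def risk_weight_def)
qed

section \<open>Cancellation within pairs and preservation of diagonality\<close>

lemma bij_\<tau>: "bij (\<tau> i)"
  using \<tau>_\<tau> by (metis bijI' )

lemma x_\<tau>: "a \<noteq> \<pi> i \<Longrightarrow> x i (\<tau> i l) $ a = - x i l $ a" "c i (\<tau> i l) = c i l"
proof -
  have eq: "x i l $ a + x i (\<tau> i l) $ a = ((2 * c i l * N i) *\<^sub>R axis (\<pi> i) 1) $ a" for a
    using pair[of i l] by (metis vector_add_component)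
  then show "x i (\<tau> i l) $ a = - x i l $ a" if "a \<noteq> \<pi> i"
    using eq[of a] that by (simp add: axis_def eq_neg_iff_add_eq_0 add.commute)
  show "c i (\<tau> i l) = c i l"
    using eq[of "\<pi> i"] N[of i] by (simp add: axis_def x_\<pi>)
qed

text \<open>Off the direction of the optimal token the coordinates of paired tokens are opposite.
  Averaging the softmax mean with its reindexing by \<open>\<tau> i\<close> leaves only differences
  of paired weights, and the optimal token itself contributes nothing.\<close>

lemma force_off:
  assumes "a \<noteq> \<pi> i"
  shows "force i t $ a = - weight i t * ((\<Sum>l\<in>UNIV. (s i t l - s i t (\<tau> i l)) * x i l $ a) / 2)"
proof -
  have "(\<Sum>l\<in>UNIV. s i t l * x i l $ a) = (\<Sum>l\<in>UNIV. s i t (\<tau> i l) * x i (\<tau> i l) $ a)"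
    by (rule sum.reindex_bij_betw[OF bij_\<tau>, symmetric])
  also have "\<dots> = - (\<Sum>l\<in>UNIV. s i t (\<tau> i l) * x i l $ a)"
    by (simp add: x_\<tau>(1)[OF assms] sum_negf)
  finally have "(\<Sum>l\<in>UNIV. s i t l * x i l $ a) = (\<Sum>l\<in>UNIV. (s i t l - s i t (\<tau> i l)) * x i l $ a) / 2"
    by (simp add: left_diff_distrib sum_subtractf)
  then show ?thesis
    using assms by (simp add: force_nth x_opt axis_def)
qed

text \<open>Every term in the derivative of an off-diagonal entry contains either an off-diagonal
  entry of \<open>A t\<close> or \<open>B t\<close>, or a force component off the optimal direction.
  The latter is linear in \<open>\<delta>\<close> too, through the chain entries, logit differences,
  weight differences, \<open>force_off\<close>. The single constant \<open>M\<close> bounds all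
  remaining factors.\<close>

lemma off_diagonal_estimate:
  assumes M: "0 \<le> M" "\<And>a b. \<bar>A t $ a $ b\<bar> \<le> M" "\<And>a b. \<bar>B t $ a $ b\<bar> \<le> M" "\<And>i l a. \<bar>x i l $ a\<bar> \<le> M"
      "\<And>i. \<rho> i \<le> M" "\<And>i. weight i t \<le> M"
    and \<delta>: "0 \<le> \<delta>" "\<And>a b. pos a \<noteq> pos b \<Longrightarrow> \<bar>A t $ a $ b\<bar> \<le> \<delta>" "\<And>a b. pos a \<noteq> pos b \<Longrightarrow> \<bar>B t $ a $ b\<bar> \<le> \<delta>"
    and C1: "C1 = 2 * real CARD('d) * real CARD('e) * M ^ 3"
    and C2: "C2 = M * (real CARD('l) * C1 * M)"
    and off: "pos a \<noteq> pos b"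
  shows "\<bar>dA t a b\<bar> \<le> real CARD('n) * (2 * M ^ 3 + C2 * M\<^sup>2) * \<delta>"
    and "\<bar>dB t a b\<bar> \<le> real CARD('n) * (M * (real CARD('d) * (2 * M\<^sup>2 + M * C2))) * \<delta>"
proof -
  have C1_nonneg: "0 \<le> C1" and C2_nonneg: "0 \<le> C2" using M(1) C1 C2 by auto
  have logit_diff: "\<bar>logits i t $ l - logits i t $ \<tau> i l\<bar> \<le> C1 * \<delta>" for i l
  proof -
    \<comment> \<open>A column is diagonal for at most one of the distinct rows \<open>a\<close> and
      \<open>\<pi> i\<close>, so one of the two factors is off-diagonal.\<close>
    have prod: "\<bar>A t $ a $ b * B t $ \<pi> i $ b\<bar> \<le> M * \<delta>" if "a \<noteq> \<pi> i" for a b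
    proof (cases "pos a = pos b")
      case True
      then have "pos (\<pi> i) \<noteq> pos b" using that by (metis pos_eq_iff)
      then show ?thesis unfolding abs_mult using M \<delta> by (intro mult_mono) auto
    next
      case False
      then have "\<bar>A t $ a $ b * B t $ \<pi> i $ b\<bar> \<le> \<delta> * M" unfolding abs_mult using M \<delta> by (intro mult_mono) auto
      then show ?thesis by (simp add: mult.commute)
    qed
    have row: "\<bar>(A t *v (B t $ \<pi> i)) $ a\<bar> \<le> real CARD('e) * (M * \<delta>)" if "a \<noteq> \<pi> i" for a
      unfolding matrix_vector_mult_def using sum_norm_le[of UNIV "\<lambda>b. A t $ a $ b * B t $ \<pi> i $ b" "\<lambda>_. M * \<delta>"]
      by (simp add: prod[OF that])
    \<comment> \<open>Paired tokens agree in coordinate \<open>\<pi> i\<close>, so the one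
      coordinate of the product that is not small drops out of the logit difference.\<close>
    have x_diff: "x i l $ a - x i (\<tau> i l) $ a = (if a = \<pi> i then 0 else 2 * x i l $ a)" for a
      using x_\<tau>(1)[of a i l] by (auto simp: x_\<pi> x_\<tau>(2))
    have "logits i t $ l - logits i t $ \<tau> i l
        = \<rho> i * (\<Sum>a\<in>UNIV. (x i l $ a - x i (\<tau> i l) $ a) * (A t *v (B t $ \<pi> i)) $ a)"
      by (simp add: logits inner_vec_def sum_subtractf left_diff_distrib right_diff_distrib)
    also have "\<bar>\<dots>\<bar> \<le> M * (real CARD('d) * (2 * M * (real CARD('e) * (M * \<delta>))))"
      unfolding abs_mult
    proof (rule mult_mono)
      have "\<bar>(x i l $ a - x i (\<tau> i l) $ a) * (A t *v (B t $ \<pi> i)) $ a\<bar> \<le> 2 * M * (real CARD('e) * (M * \<delta>))" for a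
      proof (cases "a = \<pi> i")
        case True
        then show ?thesis unfolding x_diff using M(1) \<delta>(1) by simp
      next
        case False
        then show ?thesis unfolding x_diff abs_mult using row[OF False] M(1) M(4)[of i l a] \<delta>(1)
          by (intro mult_mono) auto
      qed
      then show "\<bar>\<Sum>a\<in>UNIV. (x i l $ a - x i (\<tau> i l) $ a) * (A t *v (B t $ \<pi> i)) $ a\<bar>
          \<le> real CARD('d) * (2 * M * (real CARD('e) * (M * \<delta>)))"
        using sum_norm_le[of UNIV "\<lambda>a. (x i l $ a - x i (\<tau> i l) $ a) * (A t *v (B t $ \<pi> i)) $ a"
            "\<lambda>_. 2 * M * (real CARD('e) * (M * \<delta>))"] by simp
    qed (use M \<rho>[of i] in auto)
    also have "\<dots> = 2 * real CARD('d) * real CARD('e) * M ^ 3 * \<delta>"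
      by (simp add: power3_eq_cube)
    finally show ?thesis unfolding C1 .
  qed
  have force_off_le: "\<bar>force i t $ a\<bar> \<le> C2 * \<delta>" if "a \<noteq> \<pi> i" for i a
  proof -
    have "\<bar>(s i t l - s i t (\<tau> i l)) * x i l $ a\<bar> \<le> C1 * \<delta> * M" for l
      unfolding abs_mult using abs_softmax_diff_le[of "logits i t" l "\<tau> i l"] logit_diff[of i l] M \<delta> C1_nonneg
      by (intro mult_mono) auto
    then have "\<bar>\<Sum>l\<in>UNIV. (s i t l - s i t (\<tau> i l)) * x i l $ a\<bar> \<le> real CARD('l) * (C1 * \<delta> * M)"
      using sum_norm_le[of UNIV "\<lambda>l. (s i t l - s i t (\<tau> i l)) * x i l $ a" "\<lambda>_. C1 * \<delta> * M"] by simp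
    moreover have "0 \<le> real CARD('l) * (C1 * \<delta> * M)" using C1_nonneg M(1) \<delta>(1) by simp
    ultimately have "\<bar>(\<Sum>l\<in>UNIV. (s i t l - s i t (\<tau> i l)) * x i l $ a) / 2\<bar> \<le> real CARD('l) * (C1 * \<delta> * M)"
      by simp
    then have "\<bar>force i t $ a\<bar> \<le> M * (real CARD('l) * (C1 * \<delta> * M))"
      unfolding force_off[OF that] abs_mult
      using M(1,6) weight_bounds(1) by (intro mult_mono) auto
    then show ?thesis by (simp add: C2 mult_ac)
  qed
  have force_le: "\<bar>force i t $ a\<bar> \<le> 2 * M\<^sup>2" for i a
  proof -
    have "\<bar>s i t l * x i l $ a\<bar> \<le> s i t l * M" for l
      unfolding abs_mult using softmax_nonneg M by (intro mult_mono) auto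
    then have "\<bar>\<Sum>l\<in>UNIV. s i t l * x i l $ a\<bar> \<le> (\<Sum>l\<in>UNIV. s i t l * M)"
      using sum_norm_le[of UNIV "\<lambda>l. s i t l * x i l $ a" "\<lambda>l. s i t l * M"] by simp
    also have "\<dots> = M" by (simp add: sum_softmax flip: sum_distrib_right)
    finally have "\<bar>x i (opt i) $ a - (\<Sum>l\<in>UNIV. s i t l * x i l $ a)\<bar> \<le> 2 * M"
      using M(4)[of i "opt i" a] by linarith
    then have "\<bar>force i t $ a\<bar> \<le> M * (2 * M)"
      unfolding force_nth abs_mult using M(1,6) weight_bounds(1) by (intro mult_mono) auto
    then show ?thesis by (simp add: power2_eq_square)
  qed
  have "\<bar>force i t $ a * (\<rho> i * B t $ \<pi> i $ b)\<bar> \<le> (2 * M ^ 3 + C2 * M\<^sup>2) * \<delta>" for i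
  \<comment> \<open>In the optimal direction the force is merely bounded, but the entry of
    \<open>B t\<close> is then off-diagonal; in any other direction the force itself is of order
    \<open>\<delta>\<close>.\<close>
  proof (cases "a = \<pi> i")
    case True
    then have "\<bar>force i t $ a * (\<rho> i * B t $ \<pi> i $ b)\<bar> \<le> 2 * M\<^sup>2 * (M * \<delta>)"
      unfolding abs_mult using force_le M \<delta> \<rho>[of i] off by (intro mult_mono) auto
    also have "\<dots> = 2 * M ^ 3 * \<delta>" by (simp add: power2_eq_square power3_eq_cube)
    finally show ?thesis using C2_nonneg M(1) \<delta>(1)  by (simp add: distrib_right add_increasing2)
  next
    case False
    then have "\<bar>force i t $ a * (\<rho> i * B t $ \<pi> i $ b)\<bar> \<le> C2 * \<delta> * (M * M)"
      unfolding abs_mult using force_off_le[OF False] M \<delta>(1) \<rho>[of i] C2_nonneg by (intro mult_mono) auto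
    also have "\<dots> = C2 * M\<^sup>2 * \<delta>" by (simp add: power2_eq_square)
    finally show ?thesis using M(1) \<delta>(1) by (simp add: distrib_right add_increasing)
  qed
  then show "\<bar>dA t a b\<bar> \<le> real CARD('n) * (2 * M ^ 3 + C2 * M\<^sup>2) * \<delta>"
    unfolding dA_def using sum_norm_le[of UNIV "\<lambda>i. force i t $ a * (\<rho> i * B t $ \<pi> i $ b)"
        "\<lambda>_. (2 * M ^ 3 + C2 * M\<^sup>2) * \<delta>"] by (simp add: mult.assoc)
  have "\<bar>if a = \<pi> i then \<rho> i * (\<Sum>a'\<in>UNIV. A t $ a' $ b * force i t $ a') else 0\<bar>
      \<le> M * (real CARD('d) * ((2 * M\<^sup>2 + M * C2) * \<delta>))" for i
  proof (cases "a = \<pi> i")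
    case True
    have "\<bar>A t $ a' $ b * force i t $ a'\<bar> \<le> (2 * M\<^sup>2 + M * C2) * \<delta>" for a'
    proof (cases "a' = \<pi> i")
      case True
      then have "\<bar>A t $ a' $ b * force i t $ a'\<bar> \<le> \<delta> * (2 * M\<^sup>2)"
        unfolding abs_mult using force_le \<delta> off \<open>a = \<pi> i\<close> by (intro mult_mono) auto
      also have "\<dots> \<le> (2 * M\<^sup>2 + M * C2) * \<delta>"
        using C2_nonneg M(1) \<delta>(1) by (simp add: algebra_simps)
      finally show ?thesis .
    next
      case False
      then have "\<bar>A t $ a' $ b * force i t $ a'\<bar> \<le> M * (C2 * \<delta>)"
        unfolding abs_mult using force_off_le[OF False] M C2_nonneg \<delta>(1) by (intro mult_mono) auto
      also have "\<dots> \<le> (2 * M\<^sup>2 + M * C2) * \<delta>"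
        using M(1) \<delta>(1) by (simp add: algebra_simps)
      finally show ?thesis .
    qed
    then have "\<bar>\<Sum>a'\<in>UNIV. A t $ a' $ b * force i t $ a'\<bar> \<le> real CARD('d) * ((2 * M\<^sup>2 + M * C2) * \<delta>)"
      using sum_norm_le[of UNIV "\<lambda>a'. A t $ a' $ b * force i t $ a'" "\<lambda>_. (2 * M\<^sup>2 + M * C2) * \<delta>"] by simp
    then show ?thesis
      using True M \<rho>[of i] by (simp add: abs_mult mult_mono)
  next
    case False
    then show ?thesis using M(1) C2_nonneg \<delta>(1) by simp
  qed
  then have "\<bar>dB t a b\<bar> \<le> real CARD('n) * (M * (real CARD('d) * ((2 * M\<^sup>2 + M * C2) * \<delta>)))"
    unfolding dB_def using sum_norm_le[of UNIV "\<lambda>i. if a = \<pi> i then \<rho> i * (\<Sum>a'\<in>UNIV. A t $ a' $ b * force i t $ a') else 0"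
        "\<lambda>_. M * (real CARD('d) * ((2 * M\<^sup>2 + M * C2) * \<delta>))"] by simp
  then show "\<bar>dB t a b\<bar> \<le> real CARD('n) * (M * (real CARD('d) * (2 * M\<^sup>2 + M * C2))) * \<delta>"
    by (simp add: mult.assoc)
qed

text \<open>The sum \<open>D\<close> of the squared off-diagonal entries of both factors starts at 0
  and satisfies a linear differential inequality on \<open>{0..T}\<close>, so Gronwall applies. The
  constant may depend on \<open>T\<close>, since it only uses boundedness of the flow on that
  compact interval.\<close>

lemma diagonal_preserved:
  assumes T: "0 \<le> T"
  shows "diagonal_matrix (A T)" "diagonal_matrix (B T)"
proof -
  define Off where "Off = {(a :: 'd, b :: 'e). pos a \<noteq> pos b}"
  define D where "D t = (\<Sum>(a, b)\<in>Off. (A t $ a $ b)\<^sup>2 + (B t $ a $ b)\<^sup>2)" for t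
  define D' where "D' t = (\<Sum>(a, b)\<in>Off. 2 * (A t $ a $ b * dA t a b) + 2 * (B t $ a $ b * dB t a b))" for t
  have D_deriv: "(D has_real_derivative D' t) (at t within {0..})" if "0 \<le> t" for t
    unfolding D_def D'_def case_prod_beta using that
    by (intro DERIV_sum) (auto intro!: derivative_eq_intros A_deriv B_deriv)
  have cont: "continuous_on {0..T} A" "continuous_on {0..T} B"
    unfolding continuous_on_eq_continuous_within
    by (intro ballI continuous_within_subset[OF has_vector_derivative_continuous[OF flow(1)]]
        continuous_within_subset[OF has_vector_derivative_continuous[OF flow(2)]]; simp)+
  have "bounded (A ` {0..T})" "bounded (B ` {0..T})"
    by (auto intro!: compact_imp_bounded compact_continuous_image cont)
  then obtain MA MB where MA: "\<And>t. 0 \<le> t \<Longrightarrow> t \<le> T \<Longrightarrow> norm (A t) \<le> MA"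
    and MB: "\<And>t. 0 \<le> t \<Longrightarrow> t \<le> T \<Longrightarrow> norm (B t) \<le> MB"
    unfolding bounded_iff by (metis atLeastAtMost_iff imageI)
  have entry: "\<bar>H $ a $ b\<bar> \<le> norm H" for H :: "real ^ 'e::{finite,linorder} ^ 'd::{finite,linorder}" and a b
    by (rule order_trans[OF component_le_norm_cart Finite_Cartesian_Product.norm_nth_le])
  define w where "w i = m * (exp (- g i) * \<Delta> i)" for i
  have w: "0 \<le> w i" for i using m \<Delta>[of i] by (simp add: w_def)
  \<comment> \<open>A sum of nonnegative bounds, so that it dominates each of them at once.\<close>
  define M where "M = MA + MB + (\<Sum>i\<in>UNIV. \<Sum>l\<in>UNIV. norm (x i l)) + (\<Sum>i\<in>UNIV. \<rho> i) + (\<Sum>i\<in>UNIV. w i)"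
  have parts: "0 \<le> MA" "0 \<le> MB" "0 \<le> (\<Sum>i\<in>UNIV. \<Sum>l\<in>UNIV. norm (x i l))" "0 \<le> (\<Sum>i\<in>UNIV. \<rho> i)" "0 \<le> (\<Sum>i\<in>UNIV. w i)"
    using order_trans[OF norm_ge_zero MA[of 0]] order_trans[OF norm_ge_zero MB[of 0]] T w less_imp_le[OF \<rho>]
    by (auto intro!: sum_nonneg)
  have M0: "0 \<le> M" using parts by (simp add: M_def)
  have Mx: "\<bar>x i l $ a\<bar> \<le> M" for i l a
  proof -
    have "\<bar>x i l $ a\<bar> \<le> norm (x i l)" by (rule component_le_norm_cart)
    also have "\<dots> \<le> (\<Sum>l\<in>UNIV. norm (x i l))" by (rule member_le_sum) auto
    also have "\<dots> \<le> (\<Sum>i\<in>UNIV. \<Sum>l\<in>UNIV. norm (x i l))"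
      by (rule member_le_sum[where f = "\<lambda>i. \<Sum>l\<in>UNIV. norm (x i l)"]) (auto intro: sum_nonneg)
    finally show ?thesis using parts by (simp add: M_def)
  qed
  have M\<rho>: "\<rho> i \<le> M" for i
    using member_le_sum[of i UNIV \<rho>] \<rho> parts by (auto simp: M_def less_imp_le)
  have Mw: "weight i t \<le> M" for i t
    using member_le_sum[of i UNIV w] w parts weight_bounds(2)[of i t] by (auto simp: M_def w_def)
  define C1 where "C1 = 2 * real CARD('d) * real CARD('e) * M ^ 3"
  define C2 where "C2 = M * (real CARD('l) * C1 * M)"
  define KA where "KA = real CARD('n) * (2 * M ^ 3 + C2 * M\<^sup>2)"
  define KB where "KB = real CARD('n) * (M * (real CARD('d) * (2 * M\<^sup>2 + M * C2)))"
  have D'_le: "D' t \<le> (real (card Off) * (2 * KA + 2 * KB)) * D t" if t: "0 \<le> t" "t \<le> T" for t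
  proof -
    have MAB: "\<bar>A t $ a $ b\<bar> \<le> M" "\<bar>B t $ a $ b\<bar> \<le> M" for a b
      using entry[of "A t" a b] entry[of "B t" a b] MA[OF t] MB[OF t] parts by (auto simp: M_def)
    have D0: "0 \<le> D t" unfolding D_def by (intro sum_nonneg) auto
    \<comment> \<open>This dominates every off-diagonal entry, and its square is \<open>D t\<close>,
      which makes the final estimate linear in \<open>D t\<close>.\<close>
    define \<delta> where "\<delta> = sqrt (D t)"
    have \<delta>: "0 \<le> \<delta>" "\<delta> * \<delta> = D t" using D0 by (auto simp: \<delta>_def)
    have entries: "\<bar>A t $ a $ b\<bar> \<le> \<delta>" "\<bar>B t $ a $ b\<bar> \<le> \<delta>" if "pos a \<noteq> pos b" for a b
    proof -
      have "(A t $ a $ b)\<^sup>2 + (B t $ a $ b)\<^sup>2 \<le> D t"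
        unfolding D_def
        using member_le_sum[of "(a, b)" Off "\<lambda>(a, b). (A t $ a $ b)\<^sup>2 + (B t $ a $ b)\<^sup>2"] that
        by (auto simp: Off_def)
      then have "(A t $ a $ b)\<^sup>2 \<le> D t" "(B t $ a $ b)\<^sup>2 \<le> D t"
        using zero_le_power2[of "A t $ a $ b"] zero_le_power2[of "B t $ a $ b"] by linarith+
      from this[THEN real_sqrt_le_mono] show "\<bar>A t $ a $ b\<bar> \<le> \<delta>" "\<bar>B t $ a $ b\<bar> \<le> \<delta>"
        by (simp_all add: \<delta>_def)
    qed
    have est: "\<bar>dA t a b\<bar> \<le> KA * \<delta>" "\<bar>dB t a b\<bar> \<le> KB * \<delta>" if "pos a \<noteq> pos b" for a b
      unfolding KA_def KB_def
      by (rule off_diagonal_estimate[OF M0 MAB Mx M\<rho> Mw \<delta>(1) entries C1_def C2_def that]; assumption)+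
    have "D' t \<le> (\<Sum>(a, b)\<in>Off. (2 * KA + 2 * KB) * D t)"
      unfolding D'_def
    proof (rule sum_mono, clarify)
      fix a b assume "(a, b) \<in> Off"
      then have off: "pos a \<noteq> pos b" by (simp add: Off_def)
      have "\<bar>A t $ a $ b * dA t a b\<bar> \<le> \<delta> * (KA * \<delta>)" "\<bar>B t $ a $ b * dB t a b\<bar> \<le> \<delta> * (KB * \<delta>)"
        unfolding abs_mult using est[OF off] entries[OF off] \<delta>(1) by (auto intro!: mult_mono)
      moreover have "\<delta> * (KA * \<delta>) = KA * D t" "\<delta> * (KB * \<delta>) = KB * D t" using \<delta>(2) by (simp_all add: mult_ac)
      ultimately have "A t $ a $ b * dA t a b \<le> KA * D t" "B t $ a $ b * dB t a b \<le> KB * D t" by linarith+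
      then show "2 * (A t $ a $ b * dA t a b) + 2 * (B t $ a $ b * dB t a b) \<le> (2 * KA + 2 * KB) * D t"
        by (simp add: distrib_right)
    qed
    then show ?thesis by (simp add: case_prod_beta)
  qed
  have "D T = 0"
  proof (rule Gronwall_zero[OF D_deriv D'_le])
    show "D 0 = 0"
      using init unfolding D_def Off_def diagonal_matrix_def by (intro sum.neutral) auto
    show "0 \<le> D T" unfolding D_def by (intro sum_nonneg) auto
  qed (use T in auto)
  then have "\<forall>p\<in>Off. (case p of (a, b) \<Rightarrow> (A T $ a $ b)\<^sup>2 + (B T $ a $ b)\<^sup>2) = 0"
    unfolding D_def by (subst (asm) sum_nonneg_eq_0_iff) auto
  then have "A T $ a $ b = 0 \<and> B T $ a $ b = 0" if "pos a \<noteq> pos b" for a b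
    using that by (force simp: Off_def)
  then show "diagonal_matrix (A T)" "diagonal_matrix (B T)"
    by (auto simp: diagonal_matrix_def)
qed

section \<open>Decoupled dynamics of the diagonal entries\<close>

definition \<iota> :: "'d \<Rightarrow> 'e" where "\<iota> a = (SOME b. pos b = pos a)"

text \<open>The partner column exists because there are at least as many columns as rows.\<close>

lemma pos_\<iota>: "pos (\<iota> a) = pos a"
  unfolding \<iota>_def using someI_ex[OF ex_pos_eq[OF dims]] .

lemma \<iota>_eq_iff [simp]: "\<iota> a = \<iota> b \<longleftrightarrow> a = b"
  by (metis pos_\<iota> pos_eq_iff)

definition k :: "'d \<Rightarrow> real \<Rightarrow> real" where "k a t = A t $ a $ \<iota> a"
definition q :: "'d \<Rightarrow> real \<Rightarrow> real" where "q a t = B t $ a $ \<iota> a"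

lemma entries_diagonal:
  assumes "0 \<le> t"
  shows "A t $ a $ b = (if b = \<iota> a then k a t else 0)" "B t $ a $ b = (if b = \<iota> a then q a t else 0)"
proof -
  have "pos a \<noteq> pos b" if "b \<noteq> \<iota> a"
    using that by (metis pos_\<iota> pos_eq_iff)
  then show "A t $ a $ b = (if b = \<iota> a then k a t else 0)" "B t $ a $ b = (if b = \<iota> a then q a t else 0)"
    using diagonal_preserved[OF assms] by (auto simp: diagonal_matrix_def k_def q_def)
qed

lemma product_column:
  assumes "0 \<le> t"
  shows "A t *v (B t $ \<pi> i) = (k (\<pi> i) t * q (\<pi> i) t) *\<^sub>R axis (\<pi> i) 1"
  by (auto simp: vec_eq_iff matrix_vector_mult_def entries_diagonal[OF assms] axis_def
      if_distrib[where f = "\<lambda>u. u * _"] cong: if_cong)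

definition scale :: "'n \<Rightarrow> real" where "scale i = \<rho> i * N i"

lemma scale_pos: "0 < scale i"
  using N \<rho> by (simp add: scale_def)

lemma logits_diagonal:
  assumes "0 \<le> t"
  shows "logits i t $ l = scale i * c i l * (k (\<pi> i) t * q (\<pi> i) t)"
  by (simp add: logits product_column[OF assms] inner_axis x_\<pi> scale_def)

text \<open>The rate \<open>g\<close> of the coupled system for the two diagonal entries of sample
  \<open>i\<close>, that is \<open>\<rho> i\<close> times the force along \<open>\<pi> i\<close>.
  Written with \<open>1 - c i l\<close>, its terms are nonnegative and the optimal one
  vanishes.\<close>

definition gain :: "'n \<Rightarrow> real \<Rightarrow> real" where
  "gain i t = scale i * weight i t * (\<Sum>l\<in>UNIV. s i t l * (1 - c i l))"

lemma force_\<pi>: "\<rho> i * force i t $ \<pi> i = gain i t"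
proof -
  let ?P = "\<Sum>l\<in>UNIV. s i t l * c i l"
  have "(\<Sum>l\<in>UNIV. s i t l * (1 - c i l)) = 1 - ?P"
    by (simp add: right_diff_distrib sum_subtractf sum_softmax)
  then have e1: "gain i t = scale i * weight i t * (1 - ?P)" by (simp add: gain_def)
  have "(\<Sum>l\<in>UNIV. s i t l * (c i l * N i)) = N i * ?P"
    by (simp add: sum_distrib_left mult_ac)
  then have e2: "force i t $ \<pi> i = weight i t * (N i - N i * ?P)"
    by (simp add: force_nth x_opt axis_def x_\<pi>)
  show ?thesis
    unfolding e1 e2 scale_def by (simp add: algebra_simps)
qed

text \<open>Injectivity of \<open>\<pi>\<close> lets exactly one sample drive row
  \<open>\<pi> i\<close>. For a row outside the range of \<open>\<pi>\<close>, diagonality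
  annihilates every contribution to its diagonal entry.\<close>

lemma diagonal_derivs:
  assumes "0 \<le> t"
  shows "(k (\<pi> i) has_real_derivative gain i t * q (\<pi> i) t) (at t within {0..})"
    and "(q (\<pi> i) has_real_derivative gain i t * k (\<pi> i) t) (at t within {0..})"
    and "a \<notin> range \<pi> \<Longrightarrow> (k a has_real_derivative 0) (at t within {0..})"
    and "a \<notin> range \<pi> \<Longrightarrow> (q a has_real_derivative 0) (at t within {0..})"
proof -
  have dA: "dA t a (\<iota> a) = (\<Sum>i\<in>UNIV. if a = \<pi> i then gain i t * q a t else 0)" for a
    unfolding dA_def by (intro sum.cong) (auto simp: entries_diagonal[OF assms] force_\<pi>[symmetric])
  have dB: "dB t a (\<iota> a) = (\<Sum>i\<in>UNIV. if a = \<pi> i then gain i t * k a t else 0)" for a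
    unfolding dB_def
    by (intro sum.cong) (auto simp: entries_diagonal[OF assms] force_\<pi>[symmetric]
        if_distrib[where f = "\<lambda>u. u * _"] cong: if_cong)
  have \<pi>: "\<pi> i = \<pi> j \<longleftrightarrow> i = j" for i j using inj by (auto dest: injD)
  have "k a = (\<lambda>t. A t $ a $ \<iota> a)" "q a = (\<lambda>t. B t $ a $ \<iota> a)" for a
    by (simp_all add: fun_eq_iff k_def q_def)
  then have k': "(k a has_real_derivative dA t a (\<iota> a)) (at t within {0..})"
    and q': "(q a has_real_derivative dB t a (\<iota> a)) (at t within {0..})" for a
    using A_deriv[OF assms] B_deriv[OF assms] by simp_all
  show "(k (\<pi> i) has_real_derivative gain i t * q (\<pi> i) t) (at t within {0..})"
    using k'[of "\<pi> i"] by (simp add: dA \<pi>)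
  show "(q (\<pi> i) has_real_derivative gain i t * k (\<pi> i) t) (at t within {0..})"
    using q'[of "\<pi> i"] by (simp add: dB \<pi>)
  assume a: "a \<notin> range \<pi>"
  then have "a = \<pi> i \<longleftrightarrow> False" for i by auto
  then show "(k a has_real_derivative 0) (at t within {0..})" "(q a has_real_derivative 0) (at t within {0..})"
    using k'[of a] q'[of a] by (simp_all add: dA dB)
qed

section \<open>Two-sided exponential bounds on the gain\<close>

definition gap :: "'n \<Rightarrow> real" where
  "gap i = Min ((\<lambda>l. 1 - c i l) ` (UNIV - {opt i}))"

lemma gap: "l \<noteq> opt i \<Longrightarrow> gap i \<le> 1 - c i l" "\<exists>l. l \<noteq> opt i \<and> gap i = 1 - c i l" "0 < gap i"
proof -
  show "l \<noteq> opt i \<Longrightarrow> gap i \<le> 1 - c i l" unfolding gap_def by (rule Min_le) auto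
  have "gap i \<in> (\<lambda>l. 1 - c i l) ` (UNIV - {opt i})"
    unfolding gap_def using nonopt[of i] by (intro Min_in) auto
  then show "\<exists>l. l \<noteq> opt i \<and> gap i = 1 - c i l" by auto
  then show "0 < gap i" using c(2)[of _ i] by auto
qed

lemma c_opt: "c i (opt i) = 1"
  using x_\<pi>[of i "opt i"] N[of i] by (simp add: x_opt axis_def)

lemma c_le_1: "c i l \<le> 1"
  using c(2)[of l i] c_opt[of i] by (cases "l = opt i") auto

lemma gain_nonneg: "0 \<le> gain i t"
  unfolding gain_def using scale_pos[of i] weight_bounds(1)[of i t] c_le_1
  by (intro mult_nonneg_nonneg sum_nonneg) (auto simp: softmax_nonneg)

lemma s_diagonal:
  assumes "0 \<le> t"
  shows "s i t l = s i t (opt i) * exp (- (scale i * (1 - c i l) * (k (\<pi> i) t * q (\<pi> i) t)))"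
proof -
  have "exp (logits i t $ l) = exp (logits i t $ opt i) * exp (- (scale i * (1 - c i l) * (k (\<pi> i) t * q (\<pi> i) t)))"
    unfolding logits_diagonal[OF assms] exp_add[symmetric] by (simp add: c_opt algebra_simps)
  then show ?thesis by (simp add: softmax_def)
qed

text \<open>A non-optimal softmax weight is at most the exponential with the smallest rate
  \<open>scale i * gap i\<close>. The factor 2 bounds \<open>1 - c i l\<close>, by
  \<open>c i l \<ge> -1\<close>.\<close>

lemma gain_upper:
  assumes t: "0 \<le> t" and nonneg: "0 \<le> k (\<pi> i) t * q (\<pi> i) t"
  shows "gain i t \<le> scale i * (m * (exp (- g i) * \<Delta> i)) * (2 * real CARD('l)) *
    exp (- (scale i * gap i * (k (\<pi> i) t * q (\<pi> i) t)))"
proof -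
  let ?E = "exp (- (scale i * gap i * (k (\<pi> i) t * q (\<pi> i) t)))"
  have "s i t l * (1 - c i l) \<le> ?E * 2" for l
  proof (cases "l = opt i")
    case False
    have "scale i * gap i * (k (\<pi> i) t * q (\<pi> i) t) \<le> scale i * (1 - c i l) * (k (\<pi> i) t * q (\<pi> i) t)"
      using gap(1)[OF False] scale_pos[of i] nonneg by (intro mult_right_mono mult_left_mono) auto
    then have "s i t (opt i) * exp (- (scale i * (1 - c i l) * (k (\<pi> i) t * q (\<pi> i) t))) \<le> 1 * ?E"
      using softmax_le_1 softmax_nonneg by (intro mult_mono) auto
    then have "s i t l \<le> ?E" unfolding s_diagonal[OF t, of i l] by simp
    then show ?thesis using c(1)[of i l] c_le_1[of i l] by (intro mult_mono) auto
  qed (simp add: c_opt)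
  then have "(\<Sum>l\<in>UNIV. s i t l * (1 - c i l)) \<le> (\<Sum>l\<in>(UNIV :: 'l set). ?E * 2)"
    by (intro sum_mono)
  also have "\<dots> = 2 * real CARD('l) * ?E" by simp
  finally have "gain i t \<le> scale i * (m * (exp (- g i) * \<Delta> i)) * (2 * real CARD('l) * ?E)"
    unfolding gain_def using scale_pos[of i] weight_bounds[of i t] c_le_1
    by (intro mult_mono) (auto intro!: sum_nonneg simp: softmax_nonneg)
  then show ?thesis by (simp add: mult.assoc)
qed

text \<open>For a nonnegative product the optimal token carries the largest weight, hence at least
  \<open>1 / real CARD('l)\<close>; this bounds the risk weight below. In the sum only a token
  attaining the gap is kept.\<close>

lemma gain_lower:
  assumes t: "0 \<le> t" and nonneg: "0 \<le> k (\<pi> i) t * q (\<pi> i) t"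
  shows "scale i * (m * (exp (- (g i + \<Delta> i)) * \<Delta> i * (1 / real CARD('l)))) * (1 / real CARD('l) * gap i) *
    exp (- (scale i * gap i * (k (\<pi> i) t * q (\<pi> i) t))) \<le> gain i t"
proof -
  let ?E = "exp (- (scale i * gap i * (k (\<pi> i) t * q (\<pi> i) t)))"
  have "s i t l \<le> s i t (opt i)" for l
  proof -
    have "exp (- (scale i * (1 - c i l) * (k (\<pi> i) t * q (\<pi> i) t))) \<le> 1"
      using scale_pos[of i] c_le_1[of i l] nonneg by simp
    then show ?thesis
      unfolding s_diagonal[OF t, of i l] using softmax_nonneg by (intro mult_left_le) auto
  qed
  then have "(\<Sum>l\<in>UNIV. s i t l) \<le> (\<Sum>l\<in>(UNIV :: 'l set). s i t (opt i))"
    by (rule sum_mono)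
  then have s_opt: "1 / real CARD('l) \<le> s i t (opt i)"
    by (simp add: sum_softmax divide_le_eq mult.commute)
  obtain l where l: "l \<noteq> opt i" "gap i = 1 - c i l" using gap(2) by blast
  have "1 / real CARD('l) * ?E * gap i \<le> s i t (opt i) * ?E * gap i"
    using s_opt gap(3)[of i] by (intro mult_right_mono) auto
  also have "\<dots> = s i t l * (1 - c i l)"
    unfolding s_diagonal[OF t, of i l] l(2) by simp
  also have "\<dots> \<le> (\<Sum>l\<in>UNIV. s i t l * (1 - c i l))"
    using c_le_1 softmax_nonneg by (intro member_le_sum) (auto intro!: mult_nonneg_nonneg)
  finally have sum: "1 / real CARD('l) * gap i * ?E \<le> (\<Sum>l\<in>UNIV. s i t l * (1 - c i l))"
    by (simp add: mult_ac)
  have "exp (- (g i + \<Delta> i)) * \<Delta> i * (1 / real CARD('l)) \<le> risk_weight (g i) (\<Delta> i) (logits i t) (opt i)"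
    unfolding risk_weight_def using s_opt \<Delta>[of i] softmax_le_1[of "logits i t" "opt i"]
    by (intro mult_mono) auto
  then have "m * (exp (- (g i + \<Delta> i)) * \<Delta> i * (1 / real CARD('l))) \<le> weight i t"
    unfolding weight_def using m by (intro mult_left_mono) auto
  then have "scale i * (m * (exp (- (g i + \<Delta> i)) * \<Delta> i * (1 / real CARD('l)))) * (1 / real CARD('l) * gap i * ?E) \<le> gain i t"
    unfolding gain_def using sum scale_pos[of i] weight_bounds(1)[of i t] gap(3)[of i] m \<Delta>[of i]
    by (intro mult_mono) auto
  then show ?thesis by (simp add: mult.assoc)
qed

lemma diagonal_growth:
  assumes init: "k a 0 * q a 0 = 0" "(k a 0)\<^sup>2 + (q a 0)\<^sup>2 = 2 * \<omega>\<^sup>2" "\<omega> \<noteq> 0"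
  shows "a = \<pi> i \<Longrightarrow> 0 \<le> t \<Longrightarrow> 0 \<le> k a t * q a t"
    and "a = \<pi> i \<Longrightarrow> ((\<lambda>t. scale i * gap i * (k a t * q a t) / ln t) \<longlongrightarrow> 1) at_top"
    and "a \<notin> range \<pi> \<Longrightarrow> 0 \<le> t \<Longrightarrow> k a t * q a t = 0"
proof -
  {
    assume a: "a = \<pi> i"
    have lo: "0 < scale i * (m * (exp (- (g i + \<Delta> i)) * \<Delta> i * (1 / real CARD('l)))) * (1 / real CARD('l) * gap i)"
      using scale_pos[of i] m \<Delta>[of i] gap(3)[of i] by simp
    have r: "0 < scale i * gap i" using scale_pos[of i] gap(3)[of i] by simp
    show "0 \<le> k a t * q a t" if "0 \<le> t"
      unfolding a by (rule balanced_product_growth(1)[OF diagonal_derivs(1,2) init[unfolded a] gain_nonneg lo r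
            gain_lower gain_upper], (assumption | rule that)+)
    show "((\<lambda>t. scale i * gap i * (k a t * q a t) / ln t) \<longlongrightarrow> 1) at_top"
      unfolding a by (rule balanced_product_growth(2)[OF diagonal_derivs(1,2) init[unfolded a] gain_nonneg lo r
            gain_lower gain_upper])
  }
  assume a: "a \<notin> range \<pi>" and t: "0 \<le> t"
  have "((\<lambda>t. k a t * q a t) has_real_derivative 0) (at t within {0..})" if "0 \<le> t" for t
    using DERIV_mult[OF diagonal_derivs(3,4)[OF that a]] by simp
  from nondecreasing_halfline[OF this _ t] nondecreasing_halfline[OF DERIV_minus[OF this] _ t]
  show "k a t * q a t = 0" using init by simp
qed

end

section \<open>The gradient of the loss\<close>

text \<open>Since the softmax weights sum to 1 and all non-optimal scores coincide, the attended
  score depends only on the weight of the optimal token.\<close>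

lemma loss_equal_scores:
  fixes X :: "'n::finite \<Rightarrow> real ^ 'd ^ 'l" and K Q :: "real ^ 'e ^ 'd"
  assumes g: "\<And>i l. l \<noteq> opt i \<Longrightarrow> score X y v i l = g i" and \<Delta>: "\<And>i. \<Delta> i = score X y v i (opt i) - g i"
  shows "loss X z y v K Q = (\<Sum>i\<in>UNIV. (1 / real CARD('n)) *\<^sub>R
    exp (- (g i + \<Delta> i * softmax (\<chi> l. X i $ l \<bullet> (K *v (transpose Q *v z i))) $ opt i)))"
proof -
  have logit: "(X i ** K ** transpose Q) *v z i = (\<chi> l. X i $ l \<bullet> (K *v (transpose Q *v z i)))" for i
    by (simp add: vec_eq_iff matrix_vector_mul_assoc[symmetric] matrix_vector_mul_component)
  have "y i * (v \<bullet> (transpose (X i) *v s)) = g i + \<Delta> i * s $ opt i"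
    if "(\<Sum>l\<in>UNIV. s $ l) = 1" for i and s :: "real ^ 'l"
  proof -
    have "y i * (v \<bullet> (transpose (X i) *v s)) = (\<Sum>l\<in>UNIV. score X y v i l * s $ l)"
    proof -
      have "transpose (X i) *v s = (\<Sum>l\<in>UNIV. s $ l *\<^sub>R X i $ l)"
        by (simp add: vec_eq_iff matrix_vector_mult_def transpose_def sum_component mult.commute)
      then show ?thesis by (simp add: score_def inner_sum_right sum_distrib_left mult_ac)
    qed
    also have "\<dots> = (\<Sum>l\<in>UNIV. g i * s $ l + (if l = opt i then \<Delta> i * s $ l else 0))"
      by (intro sum.cong) (auto simp: g \<Delta> algebra_simps)
    also have "\<dots> = g i + \<Delta> i * s $ opt i"
      using that by (simp add: sum.distrib flip: sum_distrib_left)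
    finally show ?thesis .
  qed
  from this[OF sum_softmax] show ?thesis
    by (simp add: loss_def logit sum_distrib_left sum_divide_distrib)
qed

text \<open>Minus the gradient of the loss term of sample \<open>i\<close> with respect to the
  vector \<open>K *v (transpose Q *v z i)\<close>; both matrix gradients follow from it by the chain
  rule.\<close>

definition token_force ::
  "('n::finite \<Rightarrow> real ^ 'd ^ 'l) \<Rightarrow> ('n \<Rightarrow> real ^ 'd) \<Rightarrow> ('n \<Rightarrow> 'l) \<Rightarrow> ('n \<Rightarrow> real) \<Rightarrow> ('n \<Rightarrow> real) \<Rightarrow>
   real ^ 'e ^ 'd \<Rightarrow> real ^ 'e ^ 'd \<Rightarrow> 'n \<Rightarrow> real ^ 'd" where
  "token_force X z opt g \<Delta> K Q i = (let w = \<chi> l. X i $ l \<bullet> (K *v (transpose Q *v z i)) in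
     (1 / real CARD('n) * risk_weight (g i) (\<Delta> i) w (opt i)) *\<^sub>R
       (X i $ opt i - (\<Sum>l\<in>UNIV. softmax w $ l *\<^sub>R X i $ l)))"

text \<open>With one factor fixed, each logit is a Frobenius inner product of the other factor with
  a rank-one matrix, so \<open>GDERIV_exp_softmax\<close> applies sample by sample.\<close>

lemma gradient_loss_equal_scores:
  fixes X :: "'n::finite \<Rightarrow> real ^ 'd ^ 'l" and K Q :: "real ^ 'e ^ 'd"
  assumes g: "\<And>i l. l \<noteq> opt i \<Longrightarrow> score X y v i l = g i" and \<Delta>: "\<And>i. \<Delta> i = score X y v i (opt i) - g i"
  shows "gradient (\<lambda>A. loss X z y v A Q) K = - (\<Sum>i\<in>UNIV. outer (token_force X z opt g \<Delta> K Q i) (transpose Q *v z i))"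
    and "gradient (\<lambda>B. loss X z y v K B) Q = - (\<Sum>i\<in>UNIV. outer (z i) (transpose K *v token_force X z opt g \<Delta> K Q i))"
proof -
  have der: "GDERIV (\<lambda>A. r *\<^sub>R exp (- (g + \<Delta> * softmax (\<chi> l. A \<bullet> M l) $ k))) x :>
      - ((r * risk_weight g \<Delta> (\<chi> l. x \<bullet> M l) k) *\<^sub>R (M k - (\<Sum>m\<in>UNIV. softmax (\<chi> l. x \<bullet> M l) $ m *\<^sub>R M m)))"
    for r g \<Delta> :: real and k :: 'l and M and x :: "real ^ 'e ^ 'd"
    using has_derivative_scaleR_right[OF GDERIV_exp_softmax[unfolded gderiv_def], of r]
    by (simp add: gderiv_def mult.assoc)
  have loss: "loss X z y v A B = (\<Sum>i\<in>UNIV. (1 / real CARD('n)) *\<^sub>R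
      exp (- (g i + \<Delta> i * softmax (\<chi> l. X i $ l \<bullet> (A *v (transpose B *v z i))) $ opt i)))" for A B :: "real ^ 'e ^ 'd"
    using g \<Delta> by (rule loss_equal_scores)
  have left: "X i $ l \<bullet> (A *v (transpose Q *v z i)) = A \<bullet> outer (X i $ l) (transpose Q *v z i)" for A i l
    by (simp add: inner_outer)
  have right: "X i $ l \<bullet> (K *v (transpose B *v z i)) = B \<bullet> outer (z i) (transpose K *v X i $ l)" for B i l
    unfolding inner_outer
    by (metis dot_lmul_matrix inner_commute transpose_transpose vector_transpose_matrix)
  show "gradient (\<lambda>A. loss X z y v A Q) K = - (\<Sum>i\<in>UNIV. outer (token_force X z opt g \<Delta> K Q i) (transpose Q *v z i))"
    unfolding loss token_force_def Let_def left sum_negf[symmetric]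
    by (intro gradient_eqI GDERIV_sum finite, unfold outer_linear_combination, rule der)
  have lin: "transpose K *v (r *\<^sub>R (p - (\<Sum>l\<in>UNIV. s l *\<^sub>R f l))) = r *\<^sub>R (transpose K *v p - (\<Sum>l\<in>UNIV. s l *\<^sub>R (transpose K *v f l)))"
    for r p and s :: "'l \<Rightarrow> real" and f
    by (simp add: matrix_vector_mult_scaleR matrix_vector_mult_diff_distrib linear_sum[OF matrix_vector_mul_linear])
  show "gradient (\<lambda>B. loss X z y v K B) Q = - (\<Sum>i\<in>UNIV. outer (z i) (transpose K *v token_force X z opt g \<Delta> K Q i))"
    unfolding loss token_force_def Let_def right lin sum_negf[symmetric]
    by (intro gradient_eqI GDERIV_sum finite, unfold outer_linear_combination, rule der)
qed

text \<open>Meant for the margin, a minimum over samples whose minimising sample may change with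
  time: all finitely many candidates share one limit.\<close>

lemma tendsto_selection:
  fixes f :: "'i::finite \<Rightarrow> 'a \<Rightarrow> 'b::topological_space"
  assumes f: "\<And>i. (f i \<longlongrightarrow> L) F" and h: "eventually (\<lambda>t. \<exists>i. h t = f i t) F"
  shows "(h \<longlongrightarrow> L) F"
proof (rule topological_tendstoI)
  fix S assume "open S" "L \<in> S"
  then have "eventually (\<lambda>t. \<forall>i. f i t \<in> S) F"
    using topological_tendstoD[OF f] by (intro eventually_all_finite) auto
  then show "eventually (\<lambda>t. h t \<in> S) F"
    using h by eventually_elim auto
qed

lemma linear_mult_Diag: "linear (\<lambda>b :: real ^ 'd. U ** Diag b ** R)"
proof (rule linearI)
  have "(U ** Diag b) $ i $ j = U $ i $ j * b $ j" for b :: "real ^ 'd" and i j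
    by (simp add: matrix_matrix_mult_def Diag_def if_distrib[where f = "\<lambda>u. _ * u"] cong: if_cong)
  then have nth: "(U ** Diag b ** R) $ i $ j = (\<Sum>k\<in>UNIV. U $ i $ k * b $ k * R $ k $ j)" for b :: "real ^ 'd" and i j
    by (simp add: matrix_matrix_mult_def)
  show "U ** Diag (b + b') ** R = U ** Diag b ** R + U ** Diag b' ** R" for b b'
    by (simp add: vec_eq_iff nth algebra_simps sum.distrib)
  show "U ** Diag (r *\<^sub>R b) ** R = r *\<^sub>R (U ** Diag b ** R)" for r b
    by (simp add: vec_eq_iff nth algebra_simps sum_distrib_left)
qed

section \<open>Optimality of the limit direction\<close>

lemma inner_matrix_vector_mult: "x \<bullet> (A *v y) = (transpose A *v x) \<bullet> y"
  for A :: "real ^ 'n ^ 'm"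
  by (metis dot_lmul_matrix transpose_transpose vector_transpose_matrix)

lemma bounded_linear_matrix_sandwich:
  fixes P :: "real ^ 'm ^ 'k" and R :: "real ^ 'p ^ 'n"
  shows "bounded_linear (\<lambda>M. P ** M ** R)"
proof -
  have "linear (\<lambda>M. P ** M ** R)"
    by (rule linearI)
      (simp_all add: vec_eq_iff matrix_matrix_mult_def algebra_simps sum.distrib sum_distrib_left sum_distrib_right)
  then show ?thesis by (simp add: linear_conv_bounded_linear)
qed

theorem theorem2:
  fixes X :: "'n::finite \<Rightarrow> real ^ 'd::{finite,linorder} ^ 'l::finite"
    and z :: "'n \<Rightarrow> real ^ 'd::{finite,linorder}" and y :: "'n \<Rightarrow> real" and v :: "real ^ 'd::{finite,linorder}"
    and opt :: "'n \<Rightarrow> 'l"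
    and K Q :: "real \<Rightarrow> real ^ 'e::{finite,linorder} ^ 'd::{finite,linorder}"
    and W :: "real \<Rightarrow> real ^ 'd::{finite,linorder} ^ 'd::{finite,linorder}" and What :: "real ^ 'd::{finite,linorder} ^ 'd::{finite,linorder}"
    and UK UQ :: "real ^ 'd::{finite,linorder} ^ 'd::{finite,linorder}" and V :: "real ^ 'e::{finite,linorder} ^ 'e::{finite,linorder}"
    and \<Lambda>K \<Lambda>Q :: "real \<Rightarrow> real ^ 'e::{finite,linorder} ^ 'd::{finite,linorder}"
    and \<xi>k \<xi>q \<beta> :: "real \<Rightarrow> real ^ 'd::{finite,linorder}" and \<omega>0 :: "real ^ 'd::{finite,linorder}"
  assumes L: "CARD('l) \<ge> 2" and de: "CARD('e) \<ge> CARD('d)"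
    and labels: "\<forall>i. y i \<in> {-1, 1}"
    and opt: "\<forall>i. optimal_token X y v i (opt i)"
    and separable: "separable X z y v opt"
    and equal_scores: "equal_nonopt_scores X y v opt"
    and initial_loss: "loss X z y v (K 0) (Q 0) \<le> initial_loss_bound X y v opt"
    and data_structure: "data_structure X z opt"
    and flow: "gradient_flow (loss X z y v) K Q"
    and W: "\<forall>t. W t = K t ** transpose (Q t)"
    and margin_nonzero: "\<forall>\<^sub>F t in at_top. margin X z opt (W t) \<noteq> 0"
    and What: "((\<lambda>t. (1 / margin X z opt (W t)) *\<^sub>R W t) \<longlongrightarrow> What) at_top"
    and bases: "alignment_bases X z opt UK UQ"
    and V: "orthogonal_matrix V"
    and \<Lambda>: "\<forall>t\<ge>0. K t = UK ** \<Lambda>K t ** transpose V \<and> Q t = UQ ** \<Lambda>Q t ** transpose V"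
    and aligned_initialization: "diagonal_matrix (\<Lambda>K 0)" "diagonal_matrix (\<Lambda>Q 0)"
    and \<xi>: "\<forall>t. \<xi>k t = diagonal_of (\<Lambda>K t) \<and> \<xi>q t = diagonal_of (\<Lambda>Q t)"
    and \<beta>: "\<forall>t. \<beta> t = \<xi>k t * \<xi>q t"
    and \<omega>0: "\<forall>a. \<omega>0 $ a \<noteq> 0"
    and init: "\<xi>k 0 * \<xi>q 0 = 0" "\<xi>k 0 * \<xi>k 0 + \<xi>q 0 * \<xi>q 0 = 2 *\<^sub>R (\<omega>0 * \<omega>0)"
  shows "(\<forall>t\<ge>0. diagonal_matrix (\<Lambda>K t) \<and> diagonal_matrix (\<Lambda>Q t)) \<and>
    (\<exists>\<beta>hat. ((\<lambda>t. (1 / margin X z opt (W t)) *\<^sub>R \<beta> t) \<longlongrightarrow> \<beta>hat) at_top \<and>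
       What = UK ** Diag \<beta>hat ** transpose UQ) \<and>
    is_arg_min nuclear_norm (\<lambda>W'. rank W' \<le> CARD('e) \<and> margin_feasible X z opt W') What"
proof -
  obtain \<pi> where \<pi>: "inj \<pi>"
    and colK: "\<And>i. (1 / norm (X i $ opt i)) *\<^sub>R X i $ opt i = column (\<pi> i) UK"
    and colQ: "\<And>i. (1 / norm (z i)) *\<^sub>R z i = column (\<pi> i) UQ"
    and UK: "orthogonal_matrix UK" and UQ: "orthogonal_matrix UQ"
    using bases by (auto simp: alignment_bases_def)
  have unit: "norm (column a UK) = 1" "norm (column a UQ) = 1" for a
    using UK UQ by (auto simp: orthogonal_matrix_orthonormal_columns)
  define N where "N i = norm (X i $ opt i)" for i
  define \<rho> where "\<rho> i = norm (z i)" for i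
  \<comment> \<open>Were the norm 0, the normalised vector would be 0 and could not equal a unit
    column.\<close>
  have N: "0 < N i" and \<rho>: "0 < \<rho> i" for i
    using colK[of i] colQ[of i] unit[of "\<pi> i"] unfolding N_def \<rho>_def by (metis norm_zero scaleR_zero_right zero_less_norm_iff zero_neq_one)+
  have x_opt: "X i $ opt i = N i *\<^sub>R column (\<pi> i) UK" and z: "z i = \<rho> i *\<^sub>R column (\<pi> i) UQ" for i
    using N[of i] \<rho>[of i] unfolding colK[of i, symmetric] colQ[of i, symmetric] by (simp_all add: N_def \<rho>_def)
  have ex_nonopt: "\<exists>l. l \<noteq> opt i" for i
  proof (rule ccontr)
    assume "\<nexists>l. l \<noteq> opt i"
    then have "(UNIV :: 'l set) = {opt i}" by auto
    then have "CARD('l) = card {opt i}" by (rule arg_cong)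
    then show False using L by simp
  qed
  define g where "g i = score X y v i (SOME l. l \<noteq> opt i)" for i
  define \<Delta> where "\<Delta> i = score X y v i (opt i) - g i" for i
  have nonopt: "(SOME l. l \<noteq> opt i) \<noteq> opt i" for i
    using someI_ex[OF ex_nonopt] .
  have scores: "score X y v i l = score X y v i l'" "score X y v i l < score X y v i (opt i)"
    if "l \<noteq> opt i" "l' \<noteq> opt i" for i l l'
    using equal_scores that unfolding equal_nonopt_scores_def by blast+
  have g: "score X y v i l = g i" if "l \<noteq> opt i" for i l
    unfolding g_def by (rule scores(1)[OF that nonopt])
  have \<Delta>: "0 < \<Delta> i" for i
    unfolding \<Delta>_def g_def using scores(2)[OF nonopt nonopt, of i] by simp

  define c where "c i l = (X i $ opt i \<bullet> X i $ l) / (N i)\<^sup>2" for i l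
  define R where "R i l l' \<longleftrightarrow> (\<exists>c0. -1 \<le> c0 \<and> c0 < 1 \<and> X i $ opt i \<bullet> (X i $ l - X i $ l') = 0 \<and>
      X i $ l + X i $ l' = (2 * c0) *\<^sub>R X i $ opt i)" for i l l'
  have "\<exists>\<tau>. \<tau> (opt i) = opt i \<and> (\<forall>l. \<tau> (\<tau> l) = l) \<and> (\<forall>l. l \<noteq> opt i \<longrightarrow> R i l (\<tau> l))" for i
  proof -
    obtain P where P: "partition_on (UNIV - {opt i}) P"
      and pairs: "\<And>p. p \<in> P \<Longrightarrow> \<exists>l l'. l \<noteq> l' \<and> p = {l, l'} \<and> R i l l'"
      using data_structure unfolding data_structure_def R_def by metis
    have "R i l' l" if "R i l l'" for l l'
      using that by (auto simp: R_def inner_diff_right add.commute)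
    then show ?thesis
      using involution_of_pairs[OF P pairs] by metis
  qed
  then obtain \<tau> where \<tau>_opt: "\<And>i. \<tau> i (opt i) = opt i" and \<tau>_\<tau>: "\<And>i l. \<tau> i (\<tau> i l) = l"
    and \<tau>: "\<And>i l. l \<noteq> opt i \<Longrightarrow> R i l (\<tau> i l)" by metis
  have c_opt: "c i (opt i) = 1" for i
    using N[of i] by (simp add: c_def N_def power2_norm_eq_inner)
  \<comment> \<open>Taking the inner product of the pair condition with the optimal token identifies
    the pair constant with the projection coefficient \<open>c i l\<close>, which is thus the same
    for both members.\<close>
  have c_nonopt: "-1 \<le> c i l \<and> c i l < 1 \<and> X i $ l + X i $ \<tau> i l = (2 * c i l) *\<^sub>R X i $ opt i"
    if l: "l \<noteq> opt i" for i l
  proof -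
    obtain c0 where c0: "-1 \<le> c0" "c0 < 1" "X i $ opt i \<bullet> (X i $ l - X i $ \<tau> i l) = 0"
      "X i $ l + X i $ \<tau> i l = (2 * c0) *\<^sub>R X i $ opt i"
      using \<tau>[OF l] by (auto simp: R_def)
    have "X i $ opt i \<bullet> (X i $ l + X i $ \<tau> i l) = 2 * c0 * (N i)\<^sup>2"
      unfolding c0(4) by (simp add: N_def power2_norm_eq_inner)
    then have "c i l = c0"
      using c0(3) N[of i] by (simp add: c_def inner_diff_right inner_add_right)
    then show ?thesis using c0 by simp
  qed
  have pair: "X i $ l + X i $ \<tau> i l = (2 * c i l) *\<^sub>R X i $ opt i" for i l
    using c_nonopt[of l i] by (cases "l = opt i") (simp_all add: \<tau>_opt c_opt flip: scaleR_2)
  have x_col: "column (\<pi> i) UK \<bullet> X i $ l = c i l * N i" for i l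
    using N[of i] unfolding colK[of i, symmetric] by (simp add: c_def N_def power2_eq_square)

  \<comment> \<open>Transport of the flow to aligned coordinates\<close>
  define x where "x i l = transpose UK *v X i $ l" for i l
  define logits :: "'n \<Rightarrow> real \<Rightarrow> real ^ 'l"
    where "logits i t = (\<chi> l. \<rho> i * (x i l \<bullet> (\<Lambda>K t *v (\<Lambda>Q t $ \<pi> i))))" for i t
  define force where "force i t = (1 / real CARD('n) * risk_weight (g i) (\<Delta> i) (logits i t) (opt i)) *\<^sub>R
          (x i (opt i) - (\<Sum>l\<in>UNIV. softmax (logits i t) $ l *\<^sub>R x i l))" for i t
  have VV: "transpose V ** V = mat 1" and UKK: "transpose UK ** UK = mat 1" and UQQ: "transpose UQ ** UQ = mat 1"
    using V UK UQ by (simp_all add: orthogonal_matrix)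
  have Qz: "transpose (Q t) *v z i = V *v (\<rho> i *\<^sub>R \<Lambda>Q t $ \<pi> i)" if "0 \<le> t" for t i
  proof -
    have "transpose (\<Lambda>Q t) *v axis (\<pi> i) 1 = \<Lambda>Q t $ \<pi> i"
      by (simp add: matrix_vector_mult_basis row_def vec_eq_iff column_def transpose_def)
    moreover have "transpose (Q t) = V ** transpose (\<Lambda>Q t) ** transpose UQ"
      using \<Lambda> that by (simp add: matrix_transpose_mul matrix_mul_assoc)
    ultimately show ?thesis
      by (simp only: z matrix_vector_mul_assoc[symmetric] matrix_vector_mult_scaleR
          orthogonal_matrix_transpose_mul_column[OF UQ])
  qed
  have logit: "(\<chi> l. X i $ l \<bullet> (K t *v (transpose (Q t) *v z i))) = logits i t" if "0 \<le> t" for t i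
  proof -
    have "K t *v (transpose (Q t) *v z i) = UK *v (\<Lambda>K t *v ((transpose V ** V) *v (\<rho> i *\<^sub>R \<Lambda>Q t $ \<pi> i)))"
      unfolding Qz[OF that] matrix_vector_mul_assoc matrix_mul_assoc using \<Lambda> that by simp
    then have "K t *v (transpose (Q t) *v z i) = UK *v (\<rho> i *\<^sub>R (\<Lambda>K t *v (\<Lambda>Q t $ \<pi> i)))"
      by (simp add: VV matrix_vector_mult_scaleR)
    then show ?thesis
      by (simp only: inner_matrix_vector_mult) (simp add: logits_def x_def vec_eq_iff)
  qed
  have force: "transpose UK *v token_force X z opt g \<Delta> (K t) (Q t) i = force i t" if "0 \<le> t" for t i
    by (simp only: token_force_def Let_def logit[OF that] force_def x_def matrix_vector_mult_scaleR
        matrix_vector_mult_diff_distrib linear_sum[OF matrix_vector_mul_linear])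
  \<comment> \<open>On \<open>{0..}\<close> the aligned factors are fixed linear images of
    \<open>K\<close> and \<open>Q\<close>, and so inherit their differentiability.\<close>
  have \<Lambda>K_eq: "\<Lambda>K t = transpose UK ** K t ** V" and \<Lambda>Q_eq: "\<Lambda>Q t = transpose UQ ** Q t ** V" if "0 \<le> t" for t
  proof -
    have "transpose UK ** K t ** V = (transpose UK ** UK) ** \<Lambda>K t ** (transpose V ** V)"
      using \<Lambda> that by (simp only: matrix_mul_assoc)
    then show "\<Lambda>K t = transpose UK ** K t ** V" by (simp add: UKK VV)
    have "transpose UQ ** Q t ** V = (transpose UQ ** UQ) ** \<Lambda>Q t ** (transpose V ** V)"
      using \<Lambda> that by (simp only: matrix_mul_assoc)
    then show "\<Lambda>Q t = transpose UQ ** Q t ** V" by (simp add: UQQ VV)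
  qed
  have \<Lambda>K_deriv: "(\<Lambda>K has_vector_derivative (\<Sum>i\<in>UNIV. outer (force i t) (\<rho> i *\<^sub>R \<Lambda>Q t $ \<pi> i))) (at t within {0..})"
    and \<Lambda>Q_deriv: "(\<Lambda>Q has_vector_derivative (\<Sum>i\<in>UNIV. outer (\<rho> i *\<^sub>R axis (\<pi> i) 1) (transpose (\<Lambda>K t) *v force i t))) (at t within {0..})"
    if t: "0 \<le> t" for t
  proof -
    have grad: "gradient (\<lambda>A. loss X z y v A (Q t)) (K t)
          = - (\<Sum>i\<in>UNIV. outer (token_force X z opt g \<Delta> (K t) (Q t) i) (transpose (Q t) *v z i))"
        "gradient (\<lambda>B. loss X z y v (K t) B) (Q t)
          = - (\<Sum>i\<in>UNIV. outer (z i) (transpose (K t) *v token_force X z opt g \<Delta> (K t) (Q t) i))"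
      by (rule gradient_loss_equal_scores; use g in \<open>simp add: \<Delta>_def\<close>)+
    have flow': "(K has_vector_derivative - gradient (\<lambda>A. loss X z y v A (Q t)) (K t)) (at t within {0..})"
        "(Q has_vector_derivative - gradient (\<lambda>B. loss X z y v (K t) B) (Q t)) (at t within {0..})"
      using flow t unfolding gradient_flow_def by blast+
    have "(K has_vector_derivative (\<Sum>i\<in>UNIV. outer (token_force X z opt g \<Delta> (K t) (Q t) i) (transpose (Q t) *v z i))) (at t within {0..})"
      using flow'(1) unfolding grad minus_minus .
    \<comment> \<open>The linear change of coordinates sends rank-one matrices to rank-one matrices,
      so the gradient keeps its form.\<close>
    from bounded_linear.has_vector_derivative[OF bounded_linear_matrix_sandwich[of "transpose UK" V] this]
    have "((\<lambda>t. transpose UK ** K t ** V) has_vector_derivative (\<Sum>i\<in>UNIV. outer (force i t) (transpose V *v (transpose (Q t) *v z i)))) (at t within {0..})"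
      by (simp only: linear_sum[OF bounded_linear.linear[OF bounded_linear_matrix_sandwich]] matrix_mul_outer outer_matrix_mul force[OF t])
    moreover have "transpose V *v (transpose (Q t) *v z i) = \<rho> i *\<^sub>R \<Lambda>Q t $ \<pi> i" for i
      by (simp only: Qz[OF t] matrix_vector_mul_assoc VV matrix_vector_mul_lid)
    ultimately show "(\<Lambda>K has_vector_derivative (\<Sum>i\<in>UNIV. outer (force i t) (\<rho> i *\<^sub>R \<Lambda>Q t $ \<pi> i))) (at t within {0..})"
      by (intro has_vector_derivative_transform[OF _ \<Lambda>K_eq]) (use t in auto)
    have "(Q has_vector_derivative (\<Sum>i\<in>UNIV. outer (z i) (transpose (K t) *v token_force X z opt g \<Delta> (K t) (Q t) i))) (at t within {0..})"
      using flow'(2) unfolding grad minus_minus .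
    from bounded_linear.has_vector_derivative[OF bounded_linear_matrix_sandwich[of "transpose UQ" V] this]
    have "((\<lambda>t. transpose UQ ** Q t ** V) has_vector_derivative (\<Sum>i\<in>UNIV. outer (transpose UQ *v z i)
        (transpose V *v (transpose (K t) *v token_force X z opt g \<Delta> (K t) (Q t) i)))) (at t within {0..})"
      by (simp only: linear_sum[OF bounded_linear.linear[OF bounded_linear_matrix_sandwich]] matrix_mul_outer outer_matrix_mul)
    moreover have "transpose UQ *v z i = \<rho> i *\<^sub>R axis (\<pi> i) 1" for i
      by (simp only: z matrix_vector_mult_scaleR orthogonal_matrix_transpose_mul_column[OF UQ])
    moreover have "transpose V *v (transpose (K t) *v token_force X z opt g \<Delta> (K t) (Q t) i) = transpose (\<Lambda>K t) *v force i t" for i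
    proof -
      have "transpose V ** transpose (K t) = (transpose V ** V) ** transpose (\<Lambda>K t) ** transpose UK"
        using \<Lambda> t by (simp only: matrix_transpose_mul matrix_mul_assoc transpose_transpose)
      then have "transpose V ** transpose (K t) = transpose (\<Lambda>K t) ** transpose UK" by (simp add: VV)
      then show ?thesis by (simp only: matrix_vector_mul_assoc force[OF t, symmetric])
    qed
    ultimately show "(\<Lambda>Q has_vector_derivative (\<Sum>i\<in>UNIV. outer (\<rho> i *\<^sub>R axis (\<pi> i) 1) (transpose (\<Lambda>K t) *v force i t))) (at t within {0..})"
      by (intro has_vector_derivative_transform[OF _ \<Lambda>Q_eq]) (use t in auto)
  qed
  interpret F: aligned_attention_flow x opt \<tau> c \<pi> N \<rho> g \<Delta> "1 / real CARD('n)" \<Lambda>K \<Lambda>Q logits force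
  proof
    show "x i (opt i) = N i *\<^sub>R axis (\<pi> i) 1" for i
      by (simp only: x_def x_opt matrix_vector_mult_scaleR orthogonal_matrix_transpose_mul_column[OF UK])
    then show "x i l + x i (\<tau> i l) = (2 * c i l * N i) *\<^sub>R axis (\<pi> i) 1" for i l
      unfolding x_def matrix_vector_right_distrib[symmetric] pair matrix_vector_mult_scaleR by simp
    show "x i l $ \<pi> i = c i l * N i" for i l
      using x_col[of i l] by (simp add: x_def transpose_def matrix_vector_mult_def column_def inner_vec_def del: vector_transpose_matrix)
    show "-1 \<le> c i l" for i l using c_nonopt[of l i] c_opt[of i] by (cases "l = opt i") auto
    show "logits i t = (\<chi> l. \<rho> i * (x i l \<bullet> (\<Lambda>K t *v (\<Lambda>Q t $ \<pi> i))))" for i t by (rule logits_def)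
  qed (use \<pi> N \<rho> \<Delta> \<tau>_opt \<tau>_\<tau> c_nonopt ex_nonopt de \<Lambda>K_deriv \<Lambda>Q_deriv aligned_initialization force_def in auto)

  \<comment> \<open>Asymptotics of the diagonal and of the margin\<close>
  have \<beta>_nth: "\<beta> t $ a = F.k a t * F.q a t" for t a
    using \<beta> \<xi> by (simp add: diagonal_of_nth[OF F.pos_\<iota>] F.k_def F.q_def)
  have init_nth: "F.k a 0 * F.q a 0 = 0" "(F.k a 0)\<^sup>2 + (F.q a 0)\<^sup>2 = 2 * (\<omega>0 $ a)\<^sup>2" for a
    using arg_cong[OF init(1), of "\<lambda>u. u $ a"] arg_cong[OF init(2), of "\<lambda>u. u $ a"] \<xi>
    by (simp_all add: diagonal_of_nth[OF F.pos_\<iota>] F.k_def F.q_def power2_eq_square)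
  define r where "r i = F.scale i * F.gap i" for i
  have r: "0 < r i" for i using F.scale_pos F.gap(3) by (simp add: r_def)
  have \<beta>_nonneg: "0 \<le> \<beta> t $ \<pi> i" if "0 \<le> t" for t i
    using F.diagonal_growth(1)[OF init_nth _ refl that] \<omega>0 by (simp add: \<beta>_nth)
  have growth: "((\<lambda>t. r i * \<beta> t $ \<pi> i / ln t) \<longlongrightarrow> 1) at_top" for i
    using F.diagonal_growth(2)[OF init_nth _ refl] \<omega>0 by (simp add: \<beta>_nth r_def)
  have \<beta>_zero: "\<beta> t $ a = 0" if "a \<notin> range \<pi>" "0 \<le> t" for t a
    using F.diagonal_growth(3)[OF init_nth _ that] \<omega>0 by (simp add: \<beta>_nth)

  have W_eq: "W t = UK ** Diag (\<beta> t) ** transpose UQ" if t: "0 \<le> t" for t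
  proof -
    have "\<Lambda>K t ** transpose (\<Lambda>Q t) = Diag (\<beta> t)"
      by (auto simp: vec_eq_iff matrix_matrix_mult_def transpose_def Diag_def F.entries_diagonal[OF t] \<beta>_nth
          if_distrib[where f = "\<lambda>u. u * _"] cong: if_cong)
    moreover have "W t = UK ** \<Lambda>K t ** (transpose V ** V) ** transpose (\<Lambda>Q t) ** transpose UQ"
      using W \<Lambda> t by (simp only: matrix_transpose_mul matrix_mul_assoc transpose_transpose)
    ultimately show ?thesis by (simp add: VV flip: matrix_mul_assoc)
  qed
  \<comment> \<open>Such a matrix maps \<open>z i\<close> to a multiple of the optimal direction, so
    only the component \<open>c i l * N i\<close> of a token enters.\<close>
  have sample_margin: "sample_margin X z opt (UK ** Diag b ** transpose UQ) i l = F.scale i * (1 - c i l) * b $ \<pi> i" for b i l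
  proof -
    have D: "Diag b *v axis (\<pi> i) 1 = b $ \<pi> i *\<^sub>R axis (\<pi> i) 1"
      unfolding matrix_vector_mult_basis by (simp add: vec_eq_iff column_def Diag_def axis_def)
    have "(UK ** Diag b ** transpose UQ) *v z i = (\<rho> i * b $ \<pi> i) *\<^sub>R column (\<pi> i) UK"
      unfolding z matrix_vector_mul_assoc[symmetric] matrix_vector_mult_scaleR
        orthogonal_matrix_transpose_mul_column[OF UQ] D
      unfolding matrix_vector_mult_basis by simp
    then show ?thesis
      using x_col[of i l] x_col[of i "opt i"]
      by (simp add: sample_margin_def inner_diff_left inner_commute c_opt F.scale_def algebra_simps)
  qed
  have margin_selects: "\<exists>i. margin X z opt (W t) = r i * \<beta> t $ \<pi> i" if t: "0 \<le> t" for t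
  proof -
    let ?M = "{sample_margin X z opt (W t) i l | i l. l \<noteq> opt i}"
    have "?M = (\<lambda>(i, l). sample_margin X z opt (W t) i l) ` {(i, l). l \<noteq> opt i}" by auto
    then have fin: "finite ?M" by simp
    have "?M \<noteq> {}" using ex_nonopt by blast
    then have "margin X z opt (W t) \<in> ?M" unfolding margin_def by (rule Min_in[OF fin])
    then obtain i l where il: "l \<noteq> opt i" "margin X z opt (W t) = F.scale i * (1 - c i l) * \<beta> t $ \<pi> i"
      by (auto simp: W_eq[OF t] sample_margin)
    \<comment> \<open>Because \<open>\<beta> t $ \<pi> i\<close> is nonnegative, a token attaining
      the gap is the worst one of its sample.\<close>
    obtain l' where l': "l' \<noteq> opt i" "F.gap i = 1 - c i l'" using F.gap(2) by blast
    have "margin X z opt (W t) \<le> r i * \<beta> t $ \<pi> i"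
      unfolding margin_def using l' by (intro Min_le[OF fin]) (auto simp: W_eq[OF t] sample_margin r_def intro!: exI[of _ i] exI[of _ l'])
    moreover have "r i * \<beta> t $ \<pi> i \<le> margin X z opt (W t)"
      unfolding il(2) r_def using F.gap(1)[OF il(1)] F.scale_pos[of i] \<beta>_nonneg[OF t, of i]
      by (intro mult_right_mono mult_left_mono) auto
    ultimately show ?thesis by (intro exI[of _ i]) simp
  qed
  have margin_growth: "((\<lambda>t. margin X z opt (W t) / ln t) \<longlongrightarrow> 1) at_top"
  proof (rule tendsto_selection[OF growth])
    show "\<forall>\<^sub>F t in at_top. \<exists>i. margin X z opt (W t) / ln t = r i * \<beta> t $ \<pi> i / ln t"
      using eventually_ge_at_top[of 0] by eventually_elim (metis margin_selects)
  qed

  \<comment> \<open>The limit direction\<close>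
  define \<beta>hat where "\<beta>hat = (\<chi> a. if a \<in> range \<pi> then 1 / r (inv \<pi> a) else 0)"
  have \<beta>hat_\<pi>: "\<beta>hat $ \<pi> i = 1 / r i" for i
    by (simp add: \<beta>hat_def inv_f_f[OF \<pi>])
  have \<beta>hat_lim: "((\<lambda>t. (1 / margin X z opt (W t)) *\<^sub>R \<beta> t) \<longlongrightarrow> \<beta>hat) at_top"
  proof (rule vec_tendstoI)
    fix a
    show "((\<lambda>t. ((1 / margin X z opt (W t)) *\<^sub>R \<beta> t) $ a) \<longlongrightarrow> \<beta>hat $ a) at_top"
    proof (cases "a \<in> range \<pi>")
      case True
      then obtain i where a: "a = \<pi> i" by blast
      \<comment> \<open>Both \<open>r i * \<beta> t $ \<pi> i\<close> and the margin are asymptotic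
        to \<open>ln t\<close>, so their quotient tends to 1.\<close>
      have "((\<lambda>t. r i * \<beta> t $ \<pi> i / ln t / (margin X z opt (W t) / ln t) / r i) \<longlongrightarrow> 1 / 1 / r i) at_top"
        using r[of i] by (intro tendsto_intros growth margin_growth) auto
      moreover have "\<forall>\<^sub>F t in at_top. r i * \<beta> t $ \<pi> i / ln t / (margin X z opt (W t) / ln t) / r i = ((1 / margin X z opt (W t)) *\<^sub>R \<beta> t) $ a"
        using eventually_gt_at_top[of 1] by eventually_elim (use r[of i] in \<open>simp add: a field_simps\<close>)
      ultimately have "((\<lambda>t. ((1 / margin X z opt (W t)) *\<^sub>R \<beta> t) $ a) \<longlongrightarrow> 1 / 1 / r i) at_top"
        by (rule Lim_transform_eventually)
      then show ?thesis
        unfolding a \<beta>hat_\<pi> by simp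
    next
      case False
      have "\<forall>\<^sub>F t in at_top. ((1 / margin X z opt (W t)) *\<^sub>R \<beta> t) $ a = 0"
        using eventually_ge_at_top[of 0] by eventually_elim (simp add: \<beta>_zero[OF False])
      then show ?thesis
        using False by (simp add: \<beta>hat_def tendsto_eventually)
    qed
  qed
  have What_eq: "What = UK ** Diag \<beta>hat ** transpose UQ"
  proof (rule tendsto_unique[OF _ What])
    have "bounded_linear (\<lambda>b. UK ** Diag b ** transpose UQ)"
      using linear_mult_Diag linear_conv_bounded_linear by blast
    from bounded_linear.tendsto[OF this \<beta>hat_lim]
    have "((\<lambda>t. UK ** Diag ((1 / margin X z opt (W t)) *\<^sub>R \<beta> t) ** transpose UQ) \<longlongrightarrow> UK ** Diag \<beta>hat ** transpose UQ) at_top" .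
    moreover have "\<forall>\<^sub>F t in at_top. UK ** Diag ((1 / margin X z opt (W t)) *\<^sub>R \<beta> t) ** transpose UQ = (1 / margin X z opt (W t)) *\<^sub>R W t"
      using eventually_ge_at_top[of 0]
      by eventually_elim (simp only: W_eq linear_cmul[OF linear_mult_Diag])
    ultimately show "((\<lambda>t. (1 / margin X z opt (W t)) *\<^sub>R W t) \<longlongrightarrow> UK ** Diag \<beta>hat ** transpose UQ) at_top"
      by (rule Lim_transform_eventually)
  qed simp

  \<comment> \<open>Feasibility and optimality\<close>
  have feasible: "margin_feasible X z opt What"
    unfolding margin_feasible_def What_eq sample_margin \<beta>hat_\<pi>
  proof (intro allI impI)
    fix i l assume "l \<noteq> opt i"
    then have "r i \<le> F.scale i * (1 - c i l)"
      unfolding r_def using F.gap(1) F.scale_pos[of i] by (intro mult_left_mono) auto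
    then show "1 \<le> F.scale i * (1 - c i l) * (1 / r i)"
      using r[of i] by simp
  qed
  \<comment> \<open>The rank is at most the number of rows, which does not exceed the number of
    columns of the factors.\<close>
  have rank: "rank What \<le> CARD('e)"
    using rank_bound[of What] de by simp
  have norm_What: "nuclear_norm What = (\<Sum>i\<in>UNIV. 1 / r i)"
  proof -
    have "nuclear_norm What = (\<Sum>a\<in>UNIV. \<beta>hat $ a)"
      unfolding What_eq using r by (intro nuclear_norm_orthogonal_Diag[OF UK UQ]) (auto simp: \<beta>hat_def less_imp_le)
    also have "\<dots> = (\<Sum>a\<in>range \<pi>. \<beta>hat $ a)"
      by (intro sum.mono_neutral_right) (auto simp: \<beta>hat_def)
    also have "\<dots> = (\<Sum>i\<in>UNIV. 1 / r i)"
      by (simp add: sum.reindex[OF \<pi>] \<beta>hat_\<pi>)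
    finally show ?thesis .
  qed
  have optimal: "nuclear_norm What \<le> nuclear_norm W'" if W': "margin_feasible X z opt W'" for W'
  proof -
    \<comment> \<open>Add the constraints of a token attaining the gap and of its partner: the token
      components orthogonal to the optimal one cancel, leaving \<open>2 * r i\<close> times the
      bilinear form on the data directions.\<close>
    have "1 / r i \<le> column (\<pi> i) UK \<bullet> (W' *v column (\<pi> i) UQ)" for i
    proof -
      obtain l where l: "l \<noteq> opt i" "F.gap i = 1 - c i l" using F.gap(2) by blast
      then have "\<tau> i l \<noteq> opt i" using \<tau>_\<tau> \<tau>_opt by metis
      then have "2 \<le> sample_margin X z opt W' i l + sample_margin X z opt W' i (\<tau> i l)"
        using W' l(1) unfolding margin_feasible_def by (smt (verit))
      also have "\<dots> = (2 *\<^sub>R X i $ opt i - (X i $ l + X i $ \<tau> i l)) \<bullet> (W' *v z i)"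
        by (simp add: sample_margin_def inner_diff_left inner_add_left)
      also have "\<dots> = 2 * r i * (column (\<pi> i) UK \<bullet> (W' *v column (\<pi> i) UQ))"
        unfolding pair by (simp add: x_opt z r_def l(2) F.scale_def matrix_vector_mult_scaleR inner_diff_left algebra_simps)
      finally show ?thesis using r[of i] by (simp add: divide_le_eq mult.commute)
    qed
    then have "nuclear_norm What \<le> (\<Sum>i\<in>UNIV. column (\<pi> i) UK \<bullet> (W' *v column (\<pi> i) UQ))"
      unfolding norm_What by (intro sum_mono)
    also have "\<dots> \<le> nuclear_norm W'"
      by (rule sum_inner_le_nuclear_norm)
        (auto simp: orthogonal_matrix_column_inner[OF UK] orthogonal_matrix_column_inner[OF UQ] dest: injD[OF \<pi>])
    finally show ?thesis .
  qed
  show ?thesis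
  proof (intro conjI exI allI impI)
    show "diagonal_matrix (\<Lambda>K t)" "diagonal_matrix (\<Lambda>Q t)" if "0 \<le> t" for t
      using F.diagonal_preserved[OF that] by auto
    show "is_arg_min nuclear_norm (\<lambda>W'. rank W' \<le> CARD('e) \<and> margin_feasible X z opt W') What"
      using rank feasible optimal by (auto simp: is_arg_min_def not_less)
  qed (rule \<beta>hat_lim, rule What_eq)
qed

end
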